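(* (a) There exist a continuous probability density $\varrho$ on $\mathbb{R}^2$ with compact support and a Borel vector field $b\colon\mathbb{R}^2\to\mathbb{R}^2$ with compact support such that $|b|\varrho\in L^1(\mathbb{R}^2)$ and $\Delta\varrho-\mathrm{div}(\varrho b)=0$, but $\varrho$ does not belong to the Sobolev class $W^{1,1}_{loc}(\mathbb{R}^2)$. (b) There exist also a probability density $\varrho\in C^\infty(\mathbb{R}^2)$ and a $C^\infty$ vector field $b\colon\mathbb{R}^2\to\mathbb{R}^2$ such that $\Delta\varrho-\mathrm{div}(\varrho b)=0$ and $|b|\varrho\in L^1(\mathbb{R}^2)$, but $|\nabla\varrho|$ does not belong to $L^1(\mathbb{R}^2)$.
   Context: A probability density on $\mathbb{R}^2$ is a nonnegative measurable function with integral $1$ with respect to Lebesgue measure. The equation $\Delta\varrho-\mathrm{div}(\varrho b)=0$ is understood in the weak sense: $$\int_{\mathbb{R}^2}[\Delta\varphi+\langle b,\nabla\varphi\rangle]\,\varrho\,dx=0\quad\text{for all }\varphi\in C_0^\infty(\mathbb{R}^2),$$ where $C_0^\infty(\mathbb{R}^2)$ is the class of smooth compactly supported functions. $W^{p,k}(\mathbb{R}^d)$ (first index: integrability; second index: order of differentiability) is the Sobolev space of functions in $L^p(\mathbb{R}^d)$ whose generalized partial derivatives up to order $k$ belong to $L^p(\mathbb{R}^d)$; $W^{p,k}_{loc}(\mathbb{R}^d)$ is the class of functions $f$ such that $\zeta f\in W^{p,k}(\mathbb{R}^d)$ for all $\zeta\in C_0^\infty(\mathbb{R}^d)$. *)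

theory Defs
  imports "HOL-Analysis.Analysis"
begin

definition compactly_supported :: "('a::topological_space \<Rightarrow> 'b::zero) \<Rightarrow> bool" where
  "compactly_supported f \<longleftrightarrow> compact (closure {x. f x \<noteq> 0})"

definition directional_deriv ::
    "'a::euclidean_space \<Rightarrow> ('a \<Rightarrow> 'b::real_normed_vector) \<Rightarrow> 'a \<Rightarrow> 'b" where
  "directional_deriv v f x = frechet_derivative f (at x) v"

primrec C_k :: "nat \<Rightarrow> ('a::euclidean_space \<Rightarrow> 'b::real_normed_vector) \<Rightarrow> bool" where
  "C_k 0 f \<longleftrightarrow> continuous_on UNIV f"
| "C_k (Suc k) f \<longleftrightarrow> f differentiable_on UNIV \<and> (\<forall>v. C_k k (directional_deriv v f))"

definition C_infinity :: "('a::euclidean_space \<Rightarrow> 'b::real_normed_vector) \<Rightarrow> bool" where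
  "C_infinity f \<longleftrightarrow> (\<forall>k. C_k k f)"

definition test_functions :: "('a::euclidean_space \<Rightarrow> real) set" where
  "test_functions = {\<phi>. C_infinity \<phi> \<and> compactly_supported \<phi>}"

definition gradient :: "('a::euclidean_space \<Rightarrow> real) \<Rightarrow> 'a \<Rightarrow> 'a" where
  "gradient f x = (\<Sum>e\<in>Basis. directional_deriv e f x *\<^sub>R e)"

definition laplacian :: "('a::euclidean_space \<Rightarrow> real) \<Rightarrow> 'a \<Rightarrow> real" where
  "laplacian f x = (\<Sum>e\<in>Basis. directional_deriv e (directional_deriv e f) x)"

definition probability_density :: "('a::euclidean_space \<Rightarrow> real) \<Rightarrow> bool" where
  "probability_density \<rho> \<longleftrightarrow> (\<forall>x. 0 \<le> \<rho> x) \<and> has_bochner_integral lebesgue \<rho> 1"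

text \<open>The equation \<open>\<Delta>\<rho> - div (\<rho> b) = 0\<close> in the weak sense. Here
  \<open>has_bochner_integral\<close> (rather than an equation for \<open>integral\<^sup>L\<close>) excludes the case
  where the integral is \<open>0\<close> only by the convention for non-integrable functions.\<close>

definition weak_solution :: "('a::euclidean_space \<Rightarrow> 'a) \<Rightarrow> ('a \<Rightarrow> real) \<Rightarrow> bool" where
  "weak_solution b \<rho> \<longleftrightarrow>
     (\<forall>\<phi>\<in>test_functions.
        has_bochner_integral lebesgue (\<lambda>x. (laplacian \<phi> x + b x \<bullet> gradient \<phi> x) * \<rho> x) 0)"

definition Lp_space :: "real \<Rightarrow> ('a::euclidean_space \<Rightarrow> real) set" where
  "Lp_space p = {f \<in> borel_measurable lebesgue. integrable lebesgue (\<lambda>x. \<bar>f x\<bar> powr p)}"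

text \<open>Multi-indices are represented by lists of basis vectors; the order in the list is
  irrelevant because mixed partial derivatives of test functions commute.\<close>

definition iterated_deriv :: "'a::euclidean_space list \<Rightarrow> ('a \<Rightarrow> real) \<Rightarrow> 'a \<Rightarrow> real" where
  "iterated_deriv es f = foldr directional_deriv es f"

text \<open>Meaningful for locally integrable \<open>f\<close> and \<open>g\<close>; below it is applied only to
  functions in \<open>L\<^sup>p\<close> with \<open>p \<ge> 1\<close>.\<close>

definition generalized_deriv ::
    "'a::euclidean_space list \<Rightarrow> ('a \<Rightarrow> real) \<Rightarrow> ('a \<Rightarrow> real) \<Rightarrow> bool" where
  "generalized_deriv es f g \<longleftrightarrow>
     (\<forall>\<phi>\<in>test_functions.
        (\<integral>x. f x * iterated_deriv es \<phi> x \<partial>lebesgue) =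
        (-1) ^ length es * (\<integral>x. g x * \<phi> x \<partial>lebesgue))"

text \<open>As in \<open>W\<^sup>p\<^sup>,\<^sup>k\<close>, the integrability exponent \<open>p \<ge> 1\<close> comes first and the order second.\<close>

definition sobolev :: "real \<Rightarrow> nat \<Rightarrow> ('a::euclidean_space \<Rightarrow> real) set" where
  "sobolev p k = {f \<in> Lp_space p.
     \<forall>es. set es \<subseteq> Basis \<and> length es \<le> k \<longrightarrow> (\<exists>g\<in>Lp_space p. generalized_deriv es f g)}"

definition sobolev_loc :: "real \<Rightarrow> nat \<Rightarrow> ('a::euclidean_space \<Rightarrow> real) set" where
  "sobolev_loc p k = {f. \<forall>\<zeta>\<in>test_functions. (\<lambda>x. \<zeta> x * f x) \<in> sobolev p k}"

end

theory Submission
  imports Defs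
begin

text \<open>The theorem reflects the failure of \<open>L\<^sup>1\<close> estimates for the Riesz transforms. If
  \<open>\<rho> = x\<^sub>1 g(\<bar>x\<bar>\<^sup>2)\<close> then \<open>\<Delta>\<rho> = \<partial>\<^sub>1 w\<close> with \<open>w = 2 p'(\<bar>x\<bar>\<^sup>2)\<close> and \<open>p(t) = t g(t)\<close>. Let \<open>p\<close> rise
  from \<open>0\<close> to \<open>1\<close> at \<open>t \<approx> 1/R\<close> and return to \<open>0\<close> at \<open>t \<approx> 1\<close>: then \<open>w\<close> is bounded in \<open>L\<^sup>1\<close>
  uniformly in \<open>R\<close>, whereas \<open>\<nabla>\<rho>\<close>, tested against the bounded field \<open>x\<^sub>1 x / \<bar>x\<bar>\<^sup>2\<close>, is at least of
  order \<open>log R\<close>. Filling a disc with many small copies makes \<open>\<rho>\<close> uniformly small without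
  changing the ratio of these norms. Summing such packets over disjoint discs, on top of a
  background \<open>\<beta> \<ge> 0\<close> dominating them, gives a density \<open>\<rho>\<close> of infinite variation whose flux
  \<open>v = \<nabla>\<beta> + (\<Sum> w, 0)\<close> is integrable, and \<open>b = v/\<rho>\<close>. For (a) the discs accumulate at a point, for
  (b) they escape to infinity. Infinite variation is expressed by duality with test fields, which
  contradicts both a generalized and an integrable classical gradient.\<close>

section \<open>Smooth functions\<close>

text \<open>The equation determines the flux v = \<rho> b only up to divergence-free fields, and
  this freedom is what is exploited. Where p = 1 the potential is the dipole x_1 / |x|^2, a first
  derivative of log |x|: it is harmonic and needs no flux, yet its gradient has size |x|^-2, whose
  integral over an annulus is proportional to the logarithm of the ratio of the radii. Flux is paid
  only at the two cutoffs, where the integral of |w| is 2 pi times the total variation of p,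
  whatever R is. The test field is chosen because its divergence x_1 / |x|^2 has the sign of \<rho>,
  so that nothing cancels in the pairing.

  Two obstacles shape the superposition. Packets change sign and b is a quotient by \<rho>, so each
  packet must be small against a background fixed beforehand, no matter how large its variation is.
  And the infinite variation must survive summation: the background has an integrable gradient, so
  it adds a bounded amount to every pairing, and the test field of a packet lives inside its own
  disc, so other packets cannot compensate.\<close>

lemma has_derivative_directional_deriv:
  "f differentiable at x \<Longrightarrow> (f has_derivative (\<lambda>v. directional_deriv v f x)) (at x)"
  unfolding directional_deriv_def by (simp add: frechet_derivative_works[symmetric] eta_contract_eq)

lemma directional_deriv_eqI:
  "(f has_derivative f') (at x) \<Longrightarrow> directional_deriv v f x = f' v"
  unfolding directional_deriv_def using frechet_derivative_at by metis

text \<open>Each closure property below is an induction on k that supplies the derivative in closed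
  form; uniqueness of derivatives identifies it with \<open>directional_deriv\<close>.\<close>

lemma C_k_SucI:
  assumes "\<And>x. (f has_derivative f' x) (at x)" and "\<And>v. C_k k (\<lambda>x. f' x v)"
  shows "C_k (Suc k) f"
proof -
  have "directional_deriv v f = (\<lambda>x. f' x v)" for v
    using directional_deriv_eqI[OF assms(1)] by blast
  with assms show ?thesis
    by (auto simp: differentiable_on_def differentiable_def intro: has_derivative_at_withinI)
qed

lemma C_k_Suc_has_derivative:
  "C_k (Suc k) f \<Longrightarrow> (f has_derivative (\<lambda>v. directional_deriv v f x)) (at x)"
  by (simp add: differentiable_on_def has_derivative_directional_deriv)

lemma C_k_Suc_directional: "C_k (Suc k) f \<Longrightarrow> C_k k (directional_deriv v f)"
  by simp

lemma C_k_SucD: "C_k (Suc k) f \<Longrightarrow> C_k k f"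
proof (induction k arbitrary: f)
  case 0
  then show ?case by (simp add: differentiable_imp_continuous_on)
next
  case (Suc k)
  then show ?case using C_k.simps(2) by blast
qed

lemma C_k_continuous: "C_k k f \<Longrightarrow> continuous_on UNIV f"
  by (cases k) (auto simp: differentiable_imp_continuous_on)

lemma C_k_const [simp]: "C_k k (\<lambda>x. c)"
  by (induction k arbitrary: c) (auto intro!: C_k_SucI[where f'="\<lambda>x v. 0"] simp del: C_k.simps(2))

lemma C_k_bounded_linear: "bounded_linear f \<Longrightarrow> C_k k f"
proof (cases k)
  case (Suc n)
  assume "bounded_linear f"
  then show ?thesis unfolding Suc
    by (intro C_k_SucI[where f'="\<lambda>x. f"]) (auto intro: bounded_linear_imp_has_derivative)
qed (simp add: linear_continuous_on)

lemma C_k_add: "C_k k f \<Longrightarrow> C_k k g \<Longrightarrow> C_k k (\<lambda>x. f x + g x)"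
proof (induction k arbitrary: f g)
  case 0
  then show ?case by (auto intro: continuous_intros)
next
  case (Suc k)
  show ?case
    by (rule C_k_SucI[OF has_derivative_add[OF Suc.prems[THEN C_k_Suc_has_derivative]]])
       (rule Suc.IH[OF Suc.prems[THEN C_k_Suc_directional]])
qed

lemma C_k_sum: "(\<And>i. i \<in> I \<Longrightarrow> C_k k (f i)) \<Longrightarrow> C_k k (\<lambda>x. \<Sum>i\<in>I. f i x)"
  by (induction I rule: infinite_finite_induct) (auto intro: C_k_add)

lemma C_k_bilinear:
  assumes "bounded_bilinear b"
  shows "C_k k f \<Longrightarrow> C_k k g \<Longrightarrow> C_k k (\<lambda>x. b (f x) (g x))"
proof (induction k arbitrary: f g)
  case 0
  then show ?case using bounded_bilinear.continuous_on[OF assms] by auto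
next
  case (Suc k)
  show ?case
    by (rule C_k_SucI[OF bounded_bilinear.FDERIV[OF assms Suc.prems[THEN C_k_Suc_has_derivative]]])
       (intro C_k_add Suc.IH Suc.prems[THEN C_k_Suc_directional] Suc.prems[THEN C_k_SucD])
qed

lemmas C_k_mult = C_k_bilinear[OF bounded_bilinear_mult]
lemmas C_k_scaleR = C_k_bilinear[OF bounded_bilinear_scaleR]
lemmas C_k_inner = C_k_bilinear[OF bounded_bilinear_inner]

lemma C_k_diff: "C_k k f \<Longrightarrow> C_k k g \<Longrightarrow> C_k k (\<lambda>x. f x - g x)"
  using C_k_add[of k f "\<lambda>x. (- 1) *\<^sub>R g x"] C_k_scaleR[of k "\<lambda>_. - 1" g] by simp

lemma C_k_compose:
  fixes f :: "'a::euclidean_space \<Rightarrow> 'b::euclidean_space" and F :: "'b \<Rightarrow> 'c::real_normed_vector"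
  shows "C_k k F \<Longrightarrow> C_k k f \<Longrightarrow> C_k k (\<lambda>x. F (f x))"
proof (induction k arbitrary: F)
  case 0
  then show ?case by (auto intro: continuous_on_compose2)
next
  case (Suc k)
  have lin: "linear (\<lambda>u. directional_deriv u F y)" for y
    using C_k_Suc_has_derivative[OF Suc.prems(1)] has_derivative_linear by blast
  \<comment> \<open>The chain rule differentiates F in a direction that varies with x, which the
    induction hypothesis does not cover. Expanding in the basis leaves derivatives of F in fixed
    directions, with coefficients that depend on x.\<close>
  have expand: "directional_deriv u F y = (\<Sum>e\<in>Basis. (u \<bullet> e) *\<^sub>R directional_deriv e F y)" for u y
  proof -
    have "directional_deriv (\<Sum>e\<in>Basis. (u \<bullet> e) *\<^sub>R e) F y
        = (\<Sum>e\<in>Basis. (u \<bullet> e) *\<^sub>R directional_deriv e F y)"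
      by (simp add: linear_sum[OF lin, where g="\<lambda>e. (u \<bullet> e) *\<^sub>R e"] linear_cmul[OF lin])
    then show ?thesis by (simp add: euclidean_representation)
  qed
  show ?case
  proof (rule C_k_SucI)
    show "((\<lambda>x. F (f x)) has_derivative
        (\<lambda>v. directional_deriv (directional_deriv v f x) F (f x))) (at x)" for x
      using has_derivative_compose[OF Suc.prems(2)[THEN C_k_Suc_has_derivative] Suc.prems(1)[THEN C_k_Suc_has_derivative]] .
    show "C_k k (\<lambda>x. directional_deriv (directional_deriv v f x) F (f x))" for v
      apply (subst expand)
      apply (intro C_k_sum C_k_scaleR C_k_inner C_k_const)
      using Suc.prems Suc.IH C_k_SucD by auto
  qed
qed

lemma C_k_inverse:
  fixes f :: "'a::euclidean_space \<Rightarrow> real"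
  assumes "\<And>x. f x \<noteq> 0"
  shows "C_k k f \<Longrightarrow> C_k k (\<lambda>x. inverse (f x))"
proof (induction k)
  case 0
  then show ?case using assms by (auto intro: continuous_intros)
next
  case (Suc k)
  show ?case
  proof (rule C_k_SucI)
    show "((\<lambda>x. inverse (f x)) has_derivative
        (\<lambda>v. (- 1) * (inverse (f x) * directional_deriv v f x * inverse (f x)))) (at x)" for x
      using Deriv.has_derivative_inverse[OF assms Suc.prems[THEN C_k_Suc_has_derivative]] by simp
    show "C_k k (\<lambda>x. (- 1) * (inverse (f x) * directional_deriv v f x * inverse (f x)))" for v
      using Suc C_k_SucD by (intro C_k_mult C_k_const) auto
  qed
qed

text \<open>Agreement on an open set passes to directional derivatives there, so the hypothesis
  reproduces itself one order lower. This is what makes a locally finite series of packets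
  smooth.\<close>

lemma C_k_local:
  assumes "\<And>x. \<exists>U g. open U \<and> x \<in> U \<and> C_k k g \<and> (\<forall>y\<in>U. f y = g y)"
  shows "C_k k f"
  using assms
proof (induction k arbitrary: f)
  case 0
  then show ?case
    unfolding C_k.simps continuous_on_eq_continuous_at[OF open_UNIV]
    by (metis UNIV_I continuous_on_eq_continuous_at continuous_on_eq continuous_on_subset subset_UNIV)
next
  case (Suc k)
  have der: "\<exists>U g. open U \<and> x \<in> U \<and> C_k (Suc k) g \<and>
      (\<forall>y\<in>U. (f has_derivative (\<lambda>v. directional_deriv v g y)) (at y))" for x
  proof -
    obtain U g where U: "open U" "x \<in> U" "C_k (Suc k) g" "\<forall>y\<in>U. f y = g y"
      using Suc.prems by blast
    have "(f has_derivative (\<lambda>v. directional_deriv v g y)) (at y)" if "y \<in> U" for y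
      using has_derivative_transform_within_open[OF C_k_Suc_has_derivative[OF U(3)] U(1) that] U(4) by auto
    with U show ?thesis by blast
  qed
  have "f differentiable (at x)" for x
    using der differentiable_def by blast
  moreover have "C_k k (directional_deriv v f)" for v
  proof (rule Suc.IH)
    fix x
    obtain U g where "open U" "x \<in> U" "C_k (Suc k) g"
      "\<forall>y\<in>U. (f has_derivative (\<lambda>v. directional_deriv v g y)) (at y)"
      using der by blast
    then show "\<exists>U g. open U \<and> x \<in> U \<and> C_k k g \<and> (\<forall>y\<in>U. directional_deriv v f y = g y)"
      by (intro exI[of _ U] exI[of _ "directional_deriv v g"]) (auto simp: directional_deriv_eqI)
  qed
  ultimately show ?case
    by (simp add: differentiable_on_def differentiable_at_withinI)
qed

lemma C_infinity_has_derivative: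
  "C_infinity f \<Longrightarrow> (f has_derivative (\<lambda>v. directional_deriv v f x)) (at x)"
  unfolding C_infinity_def using C_k_Suc_has_derivative by blast

lemma C_infinity_directional: "C_infinity f \<Longrightarrow> C_infinity (directional_deriv v f)"
  unfolding C_infinity_def using C_k_Suc_directional by blast

lemma C_infinity_continuous: "C_infinity f \<Longrightarrow> continuous_on S f"
  unfolding C_infinity_def using C_k_continuous continuous_on_subset by blast

lemma C_infinity_const: "C_infinity (\<lambda>x. c)"
  by (simp add: C_infinity_def)

lemma C_infinity_bounded_linear: "bounded_linear f \<Longrightarrow> C_infinity f"
  by (simp add: C_infinity_def C_k_bounded_linear)

lemma C_infinity_add: "C_infinity f \<Longrightarrow> C_infinity g \<Longrightarrow> C_infinity (\<lambda>x. f x + g x)"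
  by (simp add: C_infinity_def C_k_add)

lemma C_infinity_diff: "C_infinity f \<Longrightarrow> C_infinity g \<Longrightarrow> C_infinity (\<lambda>x. f x - g x)"
  by (simp add: C_infinity_def C_k_diff)

lemma C_infinity_sum: "(\<And>i. i \<in> I \<Longrightarrow> C_infinity (f i)) \<Longrightarrow> C_infinity (\<lambda>x. \<Sum>i\<in>I. f i x)"
  by (simp add: C_infinity_def C_k_sum)

lemma C_infinity_mult:
  fixes f g :: "'a::euclidean_space \<Rightarrow> real"
  shows "C_infinity f \<Longrightarrow> C_infinity g \<Longrightarrow> C_infinity (\<lambda>x. f x * g x)"
  by (simp add: C_infinity_def C_k_mult)

lemma C_infinity_scaleR:
  "C_infinity f \<Longrightarrow> C_infinity g \<Longrightarrow> C_infinity (\<lambda>x. f x *\<^sub>R g x)"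
  by (simp add: C_infinity_def C_k_scaleR)

lemma C_infinity_inner:
  "C_infinity f \<Longrightarrow> C_infinity g \<Longrightarrow> C_infinity (\<lambda>x. f x \<bullet> g x)"
  by (simp add: C_infinity_def C_k_inner)

lemma C_infinity_compose:
  fixes f :: "'a::euclidean_space \<Rightarrow> 'b::euclidean_space"
  shows "C_infinity F \<Longrightarrow> C_infinity f \<Longrightarrow> C_infinity (\<lambda>x. F (f x))"
  by (simp add: C_infinity_def C_k_compose)

lemma C_infinity_inverse:
  fixes f :: "'a::euclidean_space \<Rightarrow> real"
  shows "C_infinity f \<Longrightarrow> (\<And>x. f x \<noteq> 0) \<Longrightarrow> C_infinity (\<lambda>x. inverse (f x))"
  by (simp add: C_infinity_def C_k_inverse)

lemma C_infinity_local:
  assumes "\<And>x. \<exists>U g. open U \<and> x \<in> U \<and> C_infinity g \<and> (\<forall>y\<in>U. f y = g y)"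
  shows "C_infinity f"
  unfolding C_infinity_def by (intro allI C_k_local) (meson assms C_infinity_def)

lemmas C_infinity_intros = C_infinity_const C_infinity_add C_infinity_diff C_infinity_sum
  C_infinity_mult C_infinity_scaleR C_infinity_inner C_infinity_inverse
  C_infinity_directional

section \<open>Smooth transition functions on the line\<close>

definition flat_exp :: "nat \<Rightarrow> real \<Rightarrow> real" where
  "flat_exp n t = (if t > 0 then exp (- inverse t) * inverse t ^ n else 0)"

lemma flat_exp_tendsto_0: "(flat_exp n \<longlongrightarrow> 0) (at 0)"
proof -
  have "((\<lambda>t. exp (- inverse t) * inverse t ^ n) \<longlongrightarrow> (0::real)) (at_right 0)"
  proof -
    have "((\<lambda>u::real. u ^ n / exp u) \<longlongrightarrow> 0) at_top" by (rule tendsto_power_div_exp_0)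
    then have "((\<lambda>t. inverse t ^ n / exp (inverse t)) \<longlongrightarrow> (0::real)) (at_right 0)"
      by (rule filterlim_compose[OF _ filterlim_inverse_at_top_right])
    then show ?thesis by (simp add: exp_minus divide_inverse mult.commute)
  qed
  then have "(flat_exp n \<longlongrightarrow> 0) (at_right 0)"
    by (rule Lim_transform_eventually) (auto simp: eventually_at_filter flat_exp_def)
  moreover have "(flat_exp n \<longlongrightarrow> 0) (at_left 0)"
    by (rule Lim_transform_eventually[OF tendsto_const]) (auto simp: eventually_at_filter flat_exp_def)
  ultimately show ?thesis by (simp add: filterlim_at_split)
qed

text \<open>The exponent n is carried along because it closes the family under differentiation:
  smoothness of all members then follows by one induction.\<close>

lemma flat_exp_has_real_derivative:
  "(flat_exp n has_real_derivative (flat_exp (n + 2) t - real n * flat_exp (n + 1) t)) (at t)"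
proof (cases t "0::real" rule: linorder_cases)
  case less
  have "((\<lambda>t. 0) has_real_derivative 0) (at t)" by simp
  then have "(flat_exp n has_real_derivative 0) (at t)"
    by (rule DERIV_cong_ev[THEN iffD1, rotated 3])
       (use less in \<open>auto simp: flat_exp_def intro!: eventually_mono[OF eventually_nhds_in_open[of "{..<0}"]]\<close>)
  then show ?thesis using less by (simp add: flat_exp_def)
next
  case equal
  \<comment> \<open>The difference quotient at 0 is \<open>flat_exp (Suc n)\<close>, whose limit at
    0 is known for every exponent.\<close>
  have "((\<lambda>h. (flat_exp n (0 + h) - flat_exp n 0) / h) \<longlongrightarrow> 0) (at 0)"
    by (rule Lim_transform_eventually[OF flat_exp_tendsto_0[of "Suc n"]])
       (auto simp: flat_exp_def eventually_at_filter field_simps)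
  then show ?thesis using equal by (simp add: DERIV_def flat_exp_def)
next
  case greater
  have "((\<lambda>t. exp (- inverse t) * inverse t ^ n) has_real_derivative
      (flat_exp (n + 2) t - real n * flat_exp (n + 1) t)) (at t)"
  proof -
    have "((\<lambda>t. inverse t) has_real_derivative - (inverse t * inverse t)) (at t)"
      using greater by (auto intro!: derivative_eq_intros simp: power2_eq_square)
    from DERIV_mult[OF DERIV_fun_exp[OF DERIV_minus[OF this]] DERIV_power[OF this, of n]]
    show ?thesis
      using greater by (cases n) (auto simp: flat_exp_def algebra_simps elim: DERIV_cong)
  qed
  then show ?thesis
    by (rule DERIV_cong_ev[THEN iffD1, rotated 3])
       (use greater in \<open>auto simp: flat_exp_def intro!: eventually_mono[OF eventually_nhds_in_open[of "{0<..}"]]\<close>)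
qed

lemma C_infinity_flat_exp: "C_infinity (flat_exp n)"
proof -
  have "C_k k (flat_exp n)" for k
  proof (induction k arbitrary: n)
    case 0
    show ?case
      unfolding C_k.simps using DERIV_continuous_on[OF DERIV_subset[OF flat_exp_has_real_derivative]] by blast
  next
    case (Suc k)
    show ?case
      by (rule C_k_SucI[OF flat_exp_has_real_derivative[unfolded has_field_derivative_def]])
         (intro C_k_mult C_k_diff Suc.IH C_k_const)
  qed
  then show ?thesis by (simp add: C_infinity_def)
qed

text \<open>A smooth transition from 0 on t \<le> 1/2 to 1 on t \<ge> 1; the two flat functions in
  the denominator never vanish together. Starting at 1/2 rather than 0 makes
  \<open>smooth_step (a * t)\<close> vanish near t = 0 for a > 0, which is where 1/t must be
  avoided.\<close>

definition smooth_step :: "real \<Rightarrow> real" where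
  "smooth_step t = flat_exp 0 (t - 1/2) * inverse (flat_exp 0 (t - 1/2) + flat_exp 0 (1 - t))"

lemma smooth_step_denom: "flat_exp 0 (t - 1/2) + flat_exp 0 (1 - t) > 0"
  by (auto simp: flat_exp_def add_pos_pos)

lemma C_infinity_affine_real: "C_infinity (\<lambda>t::real. a * t + b)"
  by (intro C_infinity_intros C_infinity_bounded_linear[of "\<lambda>t. t"] bounded_linear_ident)

lemma C_infinity_smooth_step: "C_infinity smooth_step"
proof -
  have "C_infinity (\<lambda>t. flat_exp 0 (t - 1/2))"
    using C_infinity_compose[OF C_infinity_flat_exp C_infinity_affine_real[of 1 "-1/2"]] by simp
  moreover have "C_infinity (\<lambda>t. flat_exp 0 (1 - t))"
    using C_infinity_compose[OF C_infinity_flat_exp C_infinity_affine_real[of "-1" 1]] by simp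
  ultimately show ?thesis
    unfolding smooth_step_def [abs_def] using smooth_step_denom
    by (intro C_infinity_intros) (auto simp: less_imp_neq[symmetric])
qed

lemma smooth_step_nonneg: "0 \<le> smooth_step t"
  using smooth_step_denom[of t] by (simp add: smooth_step_def flat_exp_def)

lemma smooth_step_le_1: "smooth_step t \<le> 1"
  using smooth_step_denom[of t] by (simp add: smooth_step_def field_simps flat_exp_def)

lemma smooth_step_eq_0: "t \<le> 1/2 \<Longrightarrow> smooth_step t = 0"
  by (simp add: smooth_step_def flat_exp_def)

lemma smooth_step_eq_1: "t \<ge> 1 \<Longrightarrow> smooth_step t = 1"
  using smooth_step_denom[of t] by (simp add: smooth_step_def flat_exp_def)

text \<open>Strictness makes \<open>bump 1\<close> positive on the open unit disc, as a background
  has to be on the discs of the packets.\<close>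

lemma smooth_step_less_1: "t < 1 \<Longrightarrow> smooth_step t < 1"
  using smooth_step_denom[of t] by (simp add: smooth_step_def flat_exp_def field_simps)

section \<open>Compactly supported functions and integration by parts\<close>

lemma compactly_supportedI:
  fixes f :: "'a::t2_space \<Rightarrow> 'b::zero"
  assumes "compact K" "\<And>x. x \<notin> K \<Longrightarrow> f x = 0"
  shows "compactly_supported f"
proof -
  have "closure {x. f x \<noteq> 0} \<subseteq> K"
    using assms by (intro closure_minimal compact_imp_closed) auto
  then show ?thesis
    unfolding compactly_supported_def using compact_Int_closed[OF assms(1) closed_closure] by (metis Int_absorb1)
qed

lemma compactly_supportedE:
  fixes f :: "'a::euclidean_space \<Rightarrow> 'b::zero"
  assumes "compactly_supported f"
  obtains R where "R > 0" "\<And>x. x \<notin> cball 0 R \<Longrightarrow> f x = 0"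
proof -
  have "bounded (closure {x. f x \<noteq> 0})"
    using assms compactly_supported_def compact_imp_bounded by blast
  then obtain R where "R > 0" "closure {x. f x \<noteq> 0} \<subseteq> cball 0 R"
    by (metis bounded_subset_ballD ball_subset_cball order_trans)
  then show ?thesis using that[of R] closure_subset[of "{x. f x \<noteq> 0}"] by blast
qed

lemma compactly_supported_mult:
  fixes f g :: "'a::t2_space \<Rightarrow> 'b::mult_zero"
  shows "compactly_supported g \<Longrightarrow> compactly_supported (\<lambda>x. f x * g x)"
  by (rule compactly_supportedI[of "closure {x. g x \<noteq> 0}"])
     (auto simp: compactly_supported_def closure_def)

lemma directional_deriv_zero_outside:
  assumes "closed K" "\<And>x. x \<notin> K \<Longrightarrow> f x = 0" "x \<notin> K"
  shows "directional_deriv v f x = 0"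
proof -
  have "(f has_derivative (\<lambda>v. 0)) (at x)"
    by (rule has_derivative_transform_within_open[OF has_derivative_const[of 0], of "- K"])
       (use assms in auto)
  then show ?thesis by (rule directional_deriv_eqI)
qed

lemma compactly_supported_directional:
  "compactly_supported f \<Longrightarrow> compactly_supported (directional_deriv v f)"
proof (rule compactly_supportedI)
  show "compact (closure {x. f x \<noteq> 0})" if "compactly_supported f"
    using that by (simp add: compactly_supported_def)
  show "directional_deriv v f x = 0" if "x \<notin> closure {x. f x \<noteq> 0}" for x
    using that closure_subset[of "{x. f x \<noteq> 0}"]
    by (intro directional_deriv_zero_outside[of "closure {x. f x \<noteq> 0}"]) auto
qed

lemma integrable_compactly_supported:
  fixes f :: "'a::euclidean_space \<Rightarrow> 'b::{banach, second_countable_topology}"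
  assumes "continuous_on UNIV f" "compactly_supported f"
  shows "integrable lborel f"
proof -
  obtain R where R: "\<And>x. x \<notin> cball 0 R \<Longrightarrow> f x = 0"
    using compactly_supportedE[OF assms(2)] by metis
  have "integrable lborel (\<lambda>x. indicator (cball 0 R) x *\<^sub>R f x)"
    using assms(1) by (intro borel_integrable_compact) (auto intro: continuous_on_subset)
  moreover have "(\<lambda>x. indicator (cball 0 R) x *\<^sub>R f x) = f"
    using R by (auto simp: indicator_def fun_eq_iff)
  ultimately show ?thesis by simp
qed

lemma bounded_compactly_supported:
  fixes f :: "'a::euclidean_space \<Rightarrow> 'b::real_normed_vector"
  assumes "continuous_on UNIV f" "compactly_supported f"
  obtains B where "B > 0" "\<And>x. norm (f x) \<le> B"
proof -
  obtain R where R: "\<And>x. x \<notin> cball 0 R \<Longrightarrow> f x = 0"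
    using compactly_supportedE[OF assms(2)] by metis
  have "bounded (f ` cball 0 R)"
    by (intro compact_imp_bounded compact_continuous_image continuous_on_subset[OF assms(1)]) auto
  then obtain B where "B > 0" "\<And>x. x \<in> cball 0 R \<Longrightarrow> norm (f x) \<le> B"
    by (auto simp: bounded_pos)
  with R that[of B] show ?thesis by (metis less_eq_real_def norm_zero)
qed

section \<open>Invariance of the integral and integration by parts\<close>

lemma borel_measurable_continuous:
  "continuous_on UNIV f \<Longrightarrow> f \<in> borel_measurable borel"
  by (rule borel_measurable_continuous_onI)

lemma integral_lborel_shift:
  fixes f :: "'a::euclidean_space \<Rightarrow> 'b::{banach, second_countable_topology}"
  assumes [measurable]: "f \<in> borel_measurable borel"
  shows "integral\<^sup>L lborel (\<lambda>x. f (c + x)) = integral\<^sup>L lborel f"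
    and "integrable lborel (\<lambda>x. f (c + x)) = integrable lborel f"
  using lborel_distr_plus[of c] integral_distr[of "(+) c" lborel borel f]
    integrable_distr_eq[of "(+) c" lborel borel f] by simp_all

lemma integral_lborel_rescale:
  fixes f :: "'a::euclidean_space \<Rightarrow> real"
  assumes [measurable]: "f \<in> borel_measurable borel" and s: "s > 0"
  shows "integral\<^sup>L lborel (\<lambda>x. f ((x - c) /\<^sub>R s)) = s ^ DIM('a) * integral\<^sup>L lborel f"
proof -
  have "integral\<^sup>L lborel (\<lambda>x. f ((x - c) /\<^sub>R s))
      = integral\<^sup>L (density (distr lborel borel (\<lambda>x. c + s *\<^sub>R x)) (\<lambda>_. ennreal (\<bar>s\<bar> ^ DIM('a)))) (\<lambda>x. f ((x - c) /\<^sub>R s))"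
    using s by (subst lborel_affine[of s c]) (simp_all add: ennreal_power)
  also have "\<dots> = s ^ DIM('a) * integral\<^sup>L lborel f"
    using s by (subst integral_density) (simp_all add: integral_distr)
  finally show ?thesis .
qed

text \<open>By translation invariance every difference quotient has integral 0, and dominated
  convergence carries this to the derivative; no iterated integrals are involved.\<close>

lemma integral_directional_deriv_eq_0:
  fixes f :: "'a::euclidean_space \<Rightarrow> real"
  assumes f: "C_infinity f" "compactly_supported f"
  shows "integral\<^sup>L lborel (directional_deriv e f) = 0"
proof -
  define s where "s i x = (f (inverse (real (Suc i)) *\<^sub>R e + x) - f x) * real (Suc i)" for i x
  have [measurable]: "f \<in> borel_measurable borel" "directional_deriv e f \<in> borel_measurable borel"
    using f by (auto intro!: C_infinity_continuous C_infinity_directional borel_measurable_continuous)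
  obtain B where B: "B > 0" "\<And>x. norm (directional_deriv e f x) \<le> B"
    using bounded_compactly_supported[OF C_infinity_continuous[OF C_infinity_directional[OF f(1)]]
        compactly_supported_directional[OF f(2)]] by metis
  obtain R where R: "R > 0" "\<And>x. x \<notin> cball 0 R \<Longrightarrow> f x = 0"
    using compactly_supportedE[OF f(2)] by metis
  have line: "((\<lambda>t. f (t *\<^sub>R e + x)) has_real_derivative directional_deriv e f (t *\<^sub>R e + x)) (at t)" for t x
  proof -
    have "((\<lambda>t. t *\<^sub>R e + x) has_derivative (\<lambda>h. h *\<^sub>R e)) (at t)"
      by (auto intro!: derivative_eq_intros)
    from has_derivative_compose[OF this C_infinity_has_derivative[OF f(1)]]
    have "((\<lambda>t. f (t *\<^sub>R e + x)) has_derivative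
        (\<lambda>h. directional_deriv (h *\<^sub>R e) f (t *\<^sub>R e + x))) (at t)" .
    moreover have "directional_deriv (h *\<^sub>R e) f y = directional_deriv e f y * h" for h y
      using linear_cmul[OF has_derivative_linear[OF C_infinity_has_derivative[OF f(1)]]] by simp
    ultimately show ?thesis by (simp add: has_field_derivative_def)
  qed
  have "(\<lambda>i. integral\<^sup>L lborel (s i)) \<longlonglongrightarrow> integral\<^sup>L lborel (directional_deriv e f)"
  proof (rule integral_dominated_convergence)
    \<comment> \<open>The mean value theorem bounds the quotients by B; as the increments are at
      most 1, their supports grow by at most \<open>norm e\<close>.\<close>
    show "integrable lborel (\<lambda>x. indicator (cball 0 (R + norm e)) x *\<^sub>R B)"
      by (intro borel_integrable_compact) auto
    show "AE x in lborel. (\<lambda>i. s i x) \<longlonglongrightarrow> directional_deriv e f x"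
    proof (rule AE_I2)
      fix x
      have "((\<lambda>h. (f (h *\<^sub>R e + x) - f x) / h) \<longlongrightarrow> directional_deriv e f x) (at 0)"
        using line[of x 0] by (simp add: DERIV_def)
      then have "((\<lambda>h. (f (h *\<^sub>R e + x) - f x) / h) \<longlongrightarrow> directional_deriv e f x) (at_right 0)"
        by (rule filterlim_mono[OF _ order_refl at_within_le_at])
      moreover have "filterlim (\<lambda>i. inverse (real (Suc i))) (at_right 0) sequentially"
        unfolding filterlim_at using LIMSEQ_inverse_real_of_nat by auto
      ultimately have "(\<lambda>i. (f (inverse (real (Suc i)) *\<^sub>R e + x) - f x) / inverse (real (Suc i)))
          \<longlonglongrightarrow> directional_deriv e f x"
        by (rule filterlim_compose)
      then show "(\<lambda>i. s i x) \<longlonglongrightarrow> directional_deriv e f x"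
        by (simp add: s_def [abs_def] divide_inverse)
    qed
    show "AE x in lborel. norm (s i x) \<le> indicator (cball 0 (R + norm e)) x *\<^sub>R B" for i
    proof (rule AE_I2)
      fix x
      define h where "h = inverse (real (Suc i))"
      have h: "0 < h" "h \<le> 1" "s i x = (f (h *\<^sub>R e + x) - f x) / h"
        by (simp_all add: h_def s_def divide_inverse inverse_le_1_iff)
      show "norm (s i x) \<le> indicator (cball 0 (R + norm e)) x *\<^sub>R B"
      proof (cases "x \<in> cball 0 (R + norm e)")
        case True
        obtain z where "f (h *\<^sub>R e + x) - f (0 *\<^sub>R e + x) = (h - 0) * directional_deriv e f (z *\<^sub>R e + x)"
          using MVT2[OF h(1), of "\<lambda>t. f (t *\<^sub>R e + x)", OF line] by blast
        with h have "s i x = directional_deriv e f (z *\<^sub>R e + x)" by simp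
        with B(2) True show ?thesis by simp
      next
        case False
        have "norm x \<le> norm (h *\<^sub>R e + x) + norm (h *\<^sub>R e)"
          using norm_triangle_ineq4[of "h *\<^sub>R e + x" "h *\<^sub>R e"] by simp
        moreover have "norm (h *\<^sub>R e) \<le> norm e"
          using h by (simp add: mult_left_le_one_le)
        ultimately have "h *\<^sub>R e + x \<notin> cball 0 R" "x \<notin> cball 0 R"
          using False R(1) norm_ge_zero[of e] unfolding mem_cball_0 by linarith+
        then show ?thesis using False h R(2) by simp
      qed
    qed
    show "s i \<in> borel_measurable lborel" for i
      unfolding s_def by measurable
  qed simp
  moreover have "integral\<^sup>L lborel (s i) = 0" for i
  proof -
    have int: "integrable lborel f"
      using integrable_compactly_supported[OF C_infinity_continuous] f by blast
    show ?thesis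
      unfolding s_def using int by (simp add: integral_lborel_shift integral_mult_left_zero Bochner_Integration.integral_diff)
  qed
  ultimately show ?thesis by (simp add: LIMSEQ_const_iff)
qed

lemma directional_deriv_mult:
  fixes f g :: "'a::euclidean_space \<Rightarrow> real"
  assumes "C_infinity f" "C_infinity g"
  shows "directional_deriv e (\<lambda>x. f x * g x) x = f x * directional_deriv e g x + directional_deriv e f x * g x"
  by (rule directional_deriv_eqI[OF has_derivative_mult[OF assms[THEN C_infinity_has_derivative]]])

lemma test_functions_directional: "\<phi> \<in> test_functions \<Longrightarrow> directional_deriv e \<phi> \<in> test_functions"
  by (simp add: test_functions_def C_infinity_directional compactly_supported_directional)

lemma integrable_mult_test:
  fixes f \<phi> :: "'a::euclidean_space \<Rightarrow> real"
  assumes "continuous_on UNIV f" "\<phi> \<in> test_functions"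
  shows "integrable lborel (\<lambda>x. f x * \<phi> x)"
  using assms by (intro integrable_compactly_supported compactly_supported_mult continuous_intros)
    (auto simp: test_functions_def C_infinity_continuous)

lemma integral_by_parts_test:
  fixes f \<phi> :: "'a::euclidean_space \<Rightarrow> real"
  assumes f: "C_infinity f" and \<phi>: "\<phi> \<in> test_functions"
  shows "(\<integral>x. f x * directional_deriv e \<phi> x \<partial>lborel) = - (\<integral>x. directional_deriv e f x * \<phi> x \<partial>lborel)"
proof -
  have "0 = (\<integral>x. directional_deriv e (\<lambda>x. f x * \<phi> x) x \<partial>lborel)"
    using f \<phi> by (intro integral_directional_deriv_eq_0[symmetric] C_infinity_mult compactly_supported_mult)
      (auto simp: test_functions_def)
  also have "\<dots> = (\<integral>x. f x * directional_deriv e \<phi> x + directional_deriv e f x * \<phi> x \<partial>lborel)"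
    using f \<phi> by (simp add: directional_deriv_mult test_functions_def)
  also have "\<dots> = (\<integral>x. f x * directional_deriv e \<phi> x \<partial>lborel) + (\<integral>x. directional_deriv e f x * \<phi> x \<partial>lborel)"
    using f \<phi> by (intro Bochner_Integration.integral_add integrable_mult_test test_functions_directional)
      (auto intro: C_infinity_continuous C_infinity_directional)
  finally show ?thesis by simp
qed

section \<open>The regularised dipole\<close>

abbreviation e1 :: "real^2" where "e1 \<equiv> axis 1 1"
abbreviation e2 :: "real^2" where "e2 \<equiv> axis 2 1"

lemma sum_Basis_2: "(\<Sum>e\<in>(Basis::(real^2) set). F e) = F e1 + F e2"
proof -
  have B: "(Basis::(real^2) set) = {e1, e2}"
    by (auto simp: Basis_vec_def UNIV_2)
  have ne: "e1 \<noteq> e2" by (simp add: axis_eq_axis)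
  have "(\<Sum>e\<in>{e1, e2}. F e) = F e1 + F e2" using ne by (subst sum.insert) auto
  then show ?thesis unfolding B .
qed

lemma laplacian_2:
  "laplacian f (z::real^2) = directional_deriv e1 (directional_deriv e1 f) z + directional_deriv e2 (directional_deriv e2 f) z"
  by (simp add: laplacian_def sum_Basis_2)

lemma gradient_2:
  "gradient f (z::real^2) = directional_deriv e1 f z *\<^sub>R e1 + directional_deriv e2 f z *\<^sub>R e2"
  by (simp add: gradient_def sum_Basis_2)

lemma inner_self_2: "z \<bullet> z = (z$1)\<^sup>2 + (z$2)\<^sup>2" for z :: "real^2"
  by (simp add: inner_vec_def sum_2 power2_eq_square)

lemma C_infinity_coord: "C_infinity (\<lambda>z::real^'n. z $ i)"
  by (intro C_infinity_bounded_linear bounded_linear_vec_nth)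

lemma C_infinity_ident: "C_infinity (\<lambda>z::'a::euclidean_space. z)"
  by (intro C_infinity_bounded_linear bounded_linear_ident)

lemma C_infinity_radial:
  fixes F :: "real \<Rightarrow> 'b::real_normed_vector"
  shows "C_infinity F \<Longrightarrow> C_infinity (\<lambda>z::'a::euclidean_space. F (z \<bullet> z))"
  by (rule C_infinity_compose[OF _ C_infinity_inner[OF C_infinity_ident C_infinity_ident]])

lemma C_infinity_has_real_derivative:
  fixes F :: "real \<Rightarrow> real"
  assumes "C_infinity F"
  shows "(F has_real_derivative directional_deriv 1 F t) (at t)"
proof -
  have "directional_deriv h F t = directional_deriv 1 F t * h" for h
  proof -
    have "directional_deriv (h *\<^sub>R 1) F t = h *\<^sub>R directional_deriv 1 F t"
      by (rule linear_cmul[OF has_derivative_linear[OF C_infinity_has_derivative[OF assms]]])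
    then show ?thesis by (simp only: real_scaleR_def mult_1_right mult.commute[of h])
  qed
  then have "(\<lambda>h. directional_deriv h F t) = (*) (directional_deriv 1 F t)" by (rule ext)
  then show ?thesis
    using C_infinity_has_derivative[OF assms, of t] by (simp add: has_field_derivative_def)
qed

lemma directional_deriv_radial_at:
  fixes F :: "real \<Rightarrow> real"
  assumes "(F has_real_derivative D) (at (z \<bullet> z))"
  shows "directional_deriv v (\<lambda>z::'a::euclidean_space. F (z \<bullet> z)) z = 2 * (z \<bullet> v) * D"
proof -
  have "((\<lambda>z. z \<bullet> z) has_derivative (\<lambda>v. 2 * (z \<bullet> v))) (at z)"
    by (auto intro!: derivative_eq_intros simp: inner_commute)
  from has_derivative_compose[OF this assms[unfolded has_field_derivative_def]]
  show ?thesis by (subst directional_deriv_eqI) (auto simp: mult_ac)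
qed

lemmas directional_deriv_radial = directional_deriv_radial_at[OF C_infinity_has_real_derivative]

lemma directional_deriv_coord: "directional_deriv v (\<lambda>z::real^'n. z $ i) z = v $ i"
  by (rule directional_deriv_eqI[OF bounded_linear_imp_has_derivative[OF bounded_linear_vec_nth]])

lemma directional_deriv_add:
  "C_infinity f \<Longrightarrow> C_infinity g \<Longrightarrow>
    directional_deriv v (\<lambda>z. f z + g z) z = directional_deriv v f z + directional_deriv v g z"
  by (rule directional_deriv_eqI) (intro has_derivative_add C_infinity_has_derivative)

lemma directional_deriv_const: "directional_deriv v (\<lambda>z. c) z = 0"
  by (rule directional_deriv_eqI) auto

lemmas directional_deriv_simps = directional_deriv_radial directional_deriv_coord directional_deriv_add
  directional_deriv_mult directional_deriv_const

text \<open>A smooth replacement for 1/t on 1/a \<le> t \<le> 1/(2b). The denominator blends t into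
  the constant 1 near and below 0, so for a > 0 it is positive on the whole line. It equals t from
  1/(4a) on, while for 0 < b \<le> a the numerator vanishes up to 1/(2a): the factor 4 ensures that
  the blending only takes place where the quotient is 0.\<close>

definition ring_profile :: "real \<Rightarrow> real \<Rightarrow> real \<Rightarrow> real" where
  "ring_profile a b t = (smooth_step (a * t) - smooth_step (b * t)) *
     inverse (t * smooth_step (4 * a * t) + (1 - smooth_step (4 * a * t)))"

lemma ring_profile_denom:
  assumes "a > 0"
  shows "t * smooth_step (4 * a * t) + (1 - smooth_step (4 * a * t)) > 0"
proof (cases "t \<le> 0")
  case True
  then have "4 * a * t \<le> 1/2" using assms by (smt (verit) mult_nonneg_nonpos field_sum_of_halves)
  then show ?thesis by (simp add: smooth_step_eq_0)
next
  case False
  then show ?thesis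
    using smooth_step_nonneg[of "4 * a * t"] smooth_step_le_1[of "4 * a * t"]
    by (cases "smooth_step (4 * a * t) = 1") (auto simp: add_nonneg_pos)
qed

lemma C_infinity_smooth_step_cmult: "C_infinity (\<lambda>t. smooth_step (a * t))"
  using C_infinity_compose[OF C_infinity_smooth_step C_infinity_affine_real[of a 0]] by simp

lemma C_infinity_ring_profile: "a > 0 \<Longrightarrow> C_infinity (ring_profile a b)"
  unfolding ring_profile_def [abs_def] using ring_profile_denom[of a]
  by (intro C_infinity_intros C_infinity_smooth_step_cmult C_infinity_ident) (auto simp: less_imp_neq[symmetric])

lemma ring_profile_small:
  assumes "0 < b" "b \<le> a" "a * t \<le> 1/2"
  shows "ring_profile a b t = 0"
proof -
  have "b * t \<le> 1/2"
  proof (cases "t \<ge> 0")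
    case True
    then show ?thesis using assms mult_right_mono[of b a t] by linarith
  next
    case False
    then show ?thesis using assms mult_nonneg_nonpos[of b t] by linarith
  qed
  then show ?thesis using assms by (simp add: ring_profile_def smooth_step_eq_0)
qed

lemma ring_profile_large:
  assumes "0 < b" "b \<le> a" "b * t \<ge> 1"
  shows "ring_profile a b t = 0"
proof -
  have "t \<ge> 0" using assms by (smt (verit) mult_nonneg_nonpos)
  then have "a * t \<ge> 1" using assms mult_right_mono[of b a t] by linarith
  then show ?thesis using assms by (simp add: ring_profile_def smooth_step_eq_1)
qed

text \<open>The identity is exact for all t, since wherever the denominator differs from t both
  steps are 0. Hence p(t) = t g(t) is a difference of two steps with an explicit derivative.\<close>

lemma ring_profile_times:
  assumes "0 < b" "b \<le> a"
  shows "t * ring_profile a b t = smooth_step (a * t) - smooth_step (b * t)"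
proof (cases "4 * a * t \<ge> 1")
  case True
  then have "t > 0" using assms by (smt (verit) mult_nonneg_nonpos)
  with True show ?thesis by (simp add: ring_profile_def smooth_step_eq_1)
next
  case False
  then have *: "a * t \<le> 1/2" by simp
  have "b * t \<le> 1/2"
  proof (cases "t \<ge> 0")
    case True
    then show ?thesis using assms * mult_right_mono[of b a t] by linarith
  next
    case False
    then show ?thesis using assms mult_nonneg_nonpos[of b t] by linarith
  qed
  then show ?thesis using * ring_profile_small[OF assms *] by (simp add: smooth_step_eq_0)
qed

text \<open>The gap \<open>2 * b \<le> a\<close> separates rise from fall: at each t either the
  first step is already 1 or the second is still 0.\<close>

lemma ring_profile_nonneg:
  assumes "0 < b" "2 * b \<le> a"
  shows "0 \<le> ring_profile a b t"
proof (cases "a * t \<ge> 1")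
  case False
  then have "b * t \<le> 1/2"
    using assms mult_right_mono[of "2 * b" a t] mult_nonneg_nonpos[of b t] by (cases "t \<ge> 0") linarith+
  then show ?thesis using ring_profile_denom[of a t] assms smooth_step_nonneg[of "a * t"]
    by (simp add: ring_profile_def smooth_step_eq_0)
next
  case True
  then show ?thesis using ring_profile_denom[of a t] assms smooth_step_le_1[of "b * t"]
    by (simp add: ring_profile_def smooth_step_eq_1)
qed

lemma ring_profile_eq:
  assumes "0 < b" "b \<le> a" "a * t \<ge> 1" "b * t \<le> 1/2"
  shows "ring_profile a b t = inverse t"
proof -
  have "t > 0" using assms by (smt (verit) mult_nonneg_nonpos)
  then show ?thesis
    using ring_profile_times[OF assms(1,2), of t] assms by (simp add: smooth_step_eq_0 smooth_step_eq_1 field_simps)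
qed

lemma ring_profile_times_abs_le:
  assumes "0 < b" "b \<le> a"
  shows "\<bar>t * ring_profile a b t\<bar> \<le> 1"
  unfolding ring_profile_times[OF assms]
  using smooth_step_nonneg[of "a * t"] smooth_step_le_1[of "a * t"]
    smooth_step_nonneg[of "b * t"] smooth_step_le_1[of "b * t"] by linarith

text \<open>A packet is a pair of potentials with \<open>\<Delta>\<rho> = \<partial>\<^sub>1 w\<close>, so that the flux \<open>(w, 0)\<close> balances
  the diffusion of \<open>\<rho>\<close>, together with a test field \<open>(\<phi>, \<psi>)\<close> witnessing that the total variation
  of \<open>\<rho>\<close> is at least \<open>T\<close>.\<close>

definition packet ::
    "(real^2) set \<Rightarrow> real \<Rightarrow> real \<Rightarrow> real \<Rightarrow> (real^2 \<Rightarrow> real) \<Rightarrow> (real^2 \<Rightarrow> real) \<Rightarrow>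
      (real^2 \<Rightarrow> real) \<Rightarrow> (real^2 \<Rightarrow> real) \<Rightarrow> bool" where
  "packet K S W T \<rho> w \<phi> \<psi> \<longleftrightarrow>
     C_infinity \<rho> \<and> C_infinity w \<and> C_infinity \<phi> \<and> C_infinity \<psi> \<and>
     (\<forall>z. z \<notin> K \<longrightarrow> \<rho> z = 0 \<and> w z = 0 \<and> \<phi> z = 0 \<and> \<psi> z = 0) \<and>
     (\<forall>z. \<bar>\<rho> z\<bar> \<le> S \<and> \<bar>\<phi> z\<bar> \<le> 1 \<and> \<bar>\<psi> z\<bar> \<le> 1) \<and>
     (\<integral>z. \<bar>w z\<bar> \<partial>lborel) \<le> W \<and>
     (\<forall>z. laplacian \<rho> z = directional_deriv e1 w z) \<and>
     T \<le> (\<integral>z. \<rho> z * (directional_deriv e1 \<phi> z + directional_deriv e2 \<psi> z) \<partial>lborel)"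

text \<open>The derivative lives on [1/2, 1]. The indicator of the whole half-line is used because,
  evaluated at R |z|^2, it becomes the indicator of a disc of known area.\<close>

lemma smooth_step_deriv_bound:
  obtains L where "L > 0" "\<And>t. \<bar>directional_deriv 1 smooth_step t\<bar> \<le> L * indicator {..1} t"
proof -
  have supp: "directional_deriv 1 smooth_step t = 0" if "t \<notin> {1/2..1}" for t
  proof -
    have "t \<in> {..<1/2} \<or> t \<in> {1<..}" using that by auto
    then have "(smooth_step has_derivative (\<lambda>v. 0)) (at t)"
    proof
      assume "t \<in> {..<1/2}"
      then show ?thesis
        by (rule has_derivative_transform_within_open[OF has_derivative_const[of 0] open_lessThan])
           (auto simp: smooth_step_eq_0)
    next
      assume "t \<in> {1<..}"
      then show ?thesis
        by (rule has_derivative_transform_within_open[OF has_derivative_const[of 1] open_greaterThan])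
           (auto simp: smooth_step_eq_1)
    qed
    then show ?thesis by (rule directional_deriv_eqI)
  qed
  obtain L where "L > 0" "\<And>t. norm (directional_deriv 1 smooth_step t) \<le> L"
    using bounded_compactly_supported[OF C_infinity_continuous[OF C_infinity_directional[OF C_infinity_smooth_step]]
        compactly_supportedI[OF compact_Icc supp]] by metis
  moreover from this supp have "\<bar>directional_deriv 1 smooth_step t\<bar> \<le> L * indicator {..1} t" for t
    by (cases "t \<le> 1") auto
  ultimately show ?thesis using that by blast
qed

lemma measure_cball_2: "r \<ge> 0 \<Longrightarrow> measure lborel (cball (c::real^2) r) = pi * r\<^sup>2"
  using content_cball[of r c] by (simp add: unit_ball_vol_2)

section \<open>Laplacian of the dipole and its pairing with the test field\<close>

context
  fixes g :: "real \<Rightarrow> real"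
  assumes g: "C_infinity g"
begin

abbreviation g' where "g' \<equiv> directional_deriv 1 g"
abbreviation dipole :: "real^2 \<Rightarrow> real" where "dipole \<equiv> \<lambda>z. z$1 * g (z \<bullet> z)"
abbreviation dipole_flux :: "real^2 \<Rightarrow> real" where
  "dipole_flux \<equiv> \<lambda>z. 2 * (g (z \<bullet> z) + (z \<bullet> z) * g' (z \<bullet> z))"

lemmas dipole_smooth = C_infinity_radial[OF g] C_infinity_radial[OF C_infinity_directional[OF g]]
  C_infinity_inner[OF C_infinity_ident C_infinity_ident]
  C_infinity_coord C_infinity_mult C_infinity_add C_infinity_const C_infinity_directional g

lemma C_infinity_dipole: "C_infinity dipole" "C_infinity dipole_flux"
  by (intro dipole_smooth)+

lemma dipole_directional:
  "directional_deriv v dipole = (\<lambda>z. z$1 * (2 * (z \<bullet> v) * g' (z \<bullet> z)) + v$1 * g (z \<bullet> z))"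
  by (rule ext) (simp add: directional_deriv_simps dipole_smooth)

lemma directional_inner: "directional_deriv v (\<lambda>z. z \<bullet> u) (z::real^2) = v \<bullet> u"
  by (rule directional_deriv_eqI) (auto intro!: derivative_eq_intros)

text \<open>With t = |z|^2 both sides are z_1 (8 g'(t) + 4 t g''(t)).\<close>

lemma laplacian_dipole: "laplacian dipole z = directional_deriv e1 dipole_flux z"
proof -
  have [simp]: "C_infinity (\<lambda>z::real^2. z \<bullet> u)" for u
    by (intro C_infinity_inner C_infinity_ident C_infinity_const)
  have sq: "directional_deriv v (\<lambda>z::real^2. z \<bullet> z) z = 2 * (z \<bullet> v)" for v z
    by (rule directional_deriv_eqI) (auto intro!: derivative_eq_intros simp: inner_commute)
  show ?thesis
    unfolding laplacian_2 dipole_directional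
    by (simp add: directional_deriv_simps dipole_smooth directional_inner sq inner_axis inner_axis')
       (simp add: axis_def inner_self_2 algebra_simps power2_eq_square)
qed

end

text \<open>The field z_1 z k(t), t = |z|^2, has divergence z_1 (3 k + 2 t k'), which is z_1 / t for
  k = 1/t. Where g vanishes both sides are 0; elsewhere k is the inverse on an open set, which
  determines k' as well.\<close>

lemma dipole_divergence:
  fixes z :: "real^2"
  assumes k: "C_infinity k" and "g (z \<bullet> z) \<noteq> 0 \<Longrightarrow> open U \<and> z \<bullet> z \<in> U \<and> (\<forall>t\<in>U. t \<noteq> 0 \<and> k t = inverse t)"
  shows "z$1 * g (z \<bullet> z) * (directional_deriv e1 (\<lambda>z. z$1 * (z$1 * k (z \<bullet> z))) z +
           directional_deriv e2 (\<lambda>z. z$1 * (z$2 * k (z \<bullet> z))) z)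
       = (z$1)\<^sup>2 * g (z \<bullet> z) / (z \<bullet> z)"
proof (cases "g (z \<bullet> z) = 0")
  case False
  then have U: "open U" "z \<bullet> z \<in> U" "\<And>t. t \<in> U \<Longrightarrow> t \<noteq> 0 \<and> k t = inverse t" using assms(2) by auto
  define t where "t = z \<bullet> z"
  have t: "t \<noteq> 0" "k t = inverse t" using U(2,3)[unfolded t_def[symmetric]] U(3) by blast+
  have "(inverse has_real_derivative - (inverse t * inverse t)) (at t)"
    using t(1) by (auto intro!: derivative_eq_intros simp: power2_eq_square)
  from has_field_derivative_transform_within_open[OF this U(1), of k]
  have "(k has_real_derivative - (inverse t * inverse t)) (at t)"
    using U t_def by auto
  then have k': "directional_deriv 1 k t = - (inverse t * inverse t)"
    using C_infinity_has_real_derivative[OF k] DERIV_unique by blast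
  have "directional_deriv e1 (\<lambda>z. z$1 * (z$1 * k (z \<bullet> z))) z + directional_deriv e2 (\<lambda>z. z$1 * (z$2 * k (z \<bullet> z))) z
      = z$1 * (3 * k t + 2 * t * directional_deriv 1 k t)"
    by (simp add: directional_deriv_simps k C_infinity_radial C_infinity_coord C_infinity_mult inner_axis inner_axis' t_def)
       (simp add: axis_def inner_self_2 algebra_simps power2_eq_square)
  also have "\<dots> = z$1 / t"
    using t(1) unfolding t(2) k' by (simp add: field_simps)
  finally show ?thesis by (simp add: t_def power2_eq_square)
qed simp

text \<open>The logarithmic divergence, counted dyadically. The squares \<open>B k\<close> lie below
  the diagonal, where z_1 is comparable to |z|. The integrand z_1^2 / |z|^4 is at least 4^k / 8
  there (a rounding of 4 * 4^k / 25) and the area is 4^-k / 4, so each of the m squares contributes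
  at least 1/32.\<close>

lemma dipole_pairing_lower_bound:
  fixes g :: "real \<Rightarrow> real"
  assumes nonneg: "\<And>t. g t \<ge> 0" and eq: "\<And>t. 1 / 4 ^ (m + 1) \<le> t \<Longrightarrow> t \<le> 1/2 \<Longrightarrow> g t = inverse t"
    and int: "integrable lborel (\<lambda>z::real^2. (z$1)\<^sup>2 * g (z \<bullet> z) / (z \<bullet> z))"
  shows "real m / 32 \<le> integral\<^sup>L lborel (\<lambda>z::real^2. (z$1)\<^sup>2 * g (z \<bullet> z) / (z \<bullet> z))"
proof -
  define B :: "nat \<Rightarrow> (real^2) set" where
    "B k = box (\<chi> i. if i = 1 then 1 / 2 ^ (k + 1) else 0) (\<chi> i. if i = 1 then 1 / 2 ^ k else 1 / 2 ^ (k + 1))" for k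
  have B: "z \<in> B k \<longleftrightarrow> 1 / 2 ^ (k + 1) < z$1 \<and> z$1 < 1 / 2 ^ k \<and> 0 < z$2 \<and> z$2 < 1 / 2 ^ (k + 1)" for z k
    by (auto simp: B_def mem_box_cart forall_2)
  have measB: "measure lborel (B k) = 1 / (4 * 4 ^ k)" for k
  proof -
    have *: "(\<Prod>e\<in>(Basis::(real^2) set). F e) = F e1 * F e2" for F :: "real^2 \<Rightarrow> real"
    proof -
      have "(Basis::(real^2) set) = {e1, e2}" by (auto simp: Basis_vec_def UNIV_2)
      moreover have "e1 \<noteq> e2" by (simp add: axis_eq_axis)
      then have "(\<Prod>e\<in>{e1, e2}. F e) = F e1 * F e2" by (subst prod.insert) auto
      ultimately show ?thesis by simp
    qed
    have ball: "\<forall>e\<in>(Basis::(real^2) set). P e" if "P e1" "P e2" for P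
      using that by (auto simp: Basis_vec_def UNIV_2)
    have "measure lborel (B k) = (1 / 2 ^ k - 1 / 2 ^ (k + 1)) * (1 / 2 ^ (k + 1))"
      unfolding B_def
      by (subst measure_lborel_box_eq, subst if_P, rule ball) (simp_all add: * inner_axis field_simps)
    also have "\<dots> = 1 / (4 * 4 ^ k)"
      by (simp add: field_simps power_mult_distrib[symmetric])
    finally show ?thesis .
  qed
  let ?u = "\<lambda>z::real^2. (z$1)\<^sup>2 * g (z \<bullet> z) / (z \<bullet> z)"
  have pt: "(\<Sum>k=1..m. (4 ^ k / 8) * indicator (B k) z) \<le> ?u z" for z
  proof (cases "\<exists>k\<in>{1..m}. z \<in> B k")
    case False
    then have "(\<Sum>k=1..m. (4 ^ k / 8) * indicator (B k) z) = (0::real)"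
      by (intro sum.neutral) auto
    then show ?thesis using nonneg by simp
  next
    case True
    then obtain k where k: "1 \<le> k" "k \<le> m" "z \<in> B k" by auto
    have disj: "z \<notin> B j" if "j \<noteq> k" for j
    proof
      assume "z \<in> B j"
      then have "(1::real) / 2 ^ (k + 1) < 1 / 2 ^ j" "(1::real) / 2 ^ (j + 1) < 1 / 2 ^ k"
        using k(3) unfolding B by linarith+
      then have "(2::real) ^ j < 2 ^ (k + 1)" "(2::real) ^ k < 2 ^ (j + 1)"
        by (simp_all add: field_simps)
      then have "j < k + 1" "k < j + 1"
        by (simp_all only: power_strict_increasing_iff one_less_numeral_iff semiring_norm)
      then show False using that by simp
    qed
    have "(\<Sum>k=1..m. (4 ^ k / 8) * indicator (B k) z) = (\<Sum>j\<in>{k}. (4 ^ j / 8) * indicator (B j) z :: real)"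
      using k disj by (intro sum.mono_neutral_right) auto
    also have "\<dots> = 4 ^ k / 8" using k by simp
    also have "\<dots> \<le> ?u z"
    proof -
      define q :: real where "q = 1 / 2 ^ (k + 1)"
      have q: "q > 0" "q < z$1" "z$1 < 2 * q" "0 < z$2" "z$2 < q" using k(3) by (auto simp: B q_def)
      have q2: "q\<^sup>2 = 1 / (4 * 4 ^ k)"
      proof -
        have "((2::real) ^ k)\<^sup>2 = 4 ^ k" by (simp add: power2_eq_square power_mult_distrib[symmetric])
        then show ?thesis by (simp add: q_def power_divide power_mult_distrib)
      qed
      have a: "q\<^sup>2 \<le> (z$1)\<^sup>2" "(z$1)\<^sup>2 \<le> (2 * q)\<^sup>2" "(z$2)\<^sup>2 \<le> q\<^sup>2" "0 \<le> (z$2)\<^sup>2"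
        using q by (intro power_mono zero_le_power2; simp)+
      have t: "q\<^sup>2 \<le> z \<bullet> z" "z \<bullet> z \<le> 5 * q\<^sup>2"
        using a unfolding inner_self_2 by (simp_all only: power_mult_distrib power2_eq_square[of "2::real"])
      \<comment> \<open>\<open>k \<le> m\<close> keeps q^2 = 4^-(k+1) above the inner cutoff, and
        \<open>1 \<le> k\<close> gives 5 q^2 \<le> 5/16, below the outer one. This is why the
        squares are numbered from 1.\<close>
      have "(4::real) ^ k \<le> 4 ^ m" "(4::real) ^ 1 \<le> 4 ^ k"
        using k by (intro power_increasing; simp)+
      then have "1 / 4 ^ (m + 1) \<le> q\<^sup>2" "5 * q\<^sup>2 \<le> 1/2"
        by (auto simp: q2 field_simps)
      with t have "g (z \<bullet> z) = inverse (z \<bullet> z)" by (intro eq) auto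
      then have "?u z = (z$1)\<^sup>2 / (z \<bullet> z)\<^sup>2" by (simp add: field_simps power2_eq_square)
      moreover have "q\<^sup>2 / (5 * q\<^sup>2)\<^sup>2 \<le> (z$1)\<^sup>2 / (z \<bullet> z)\<^sup>2"
        using a t q by (intro frac_le power_mono) (auto intro!: zero_less_power less_le_trans[of 0 "q\<^sup>2" "z \<bullet> z"])
      moreover have "q\<^sup>2 / (5 * q\<^sup>2)\<^sup>2 = 4 * 4 ^ k / 25"
        unfolding q2 by (simp add: field_simps power2_eq_square)
      ultimately have "4 * 4 ^ k / 25 \<le> ?u z" by (simp only:)
      moreover have "(4::real) ^ k / 8 \<le> 4 * 4 ^ k / 25" by (simp add: field_simps)
      ultimately show ?thesis by linarith
    qed
    finally show ?thesis .
  qed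
  have [simp]: "integrable lborel (\<lambda>z. indicator (B k) z :: real)" for k
    by (rule integrable_real_indicator) (auto simp: B_def emeasure_lborel_box_eq)
  have "real m / 32 = (\<Sum>k=1..m. (4 ^ k / 8) * measure lborel (B k))"
    by (simp add: measB)
  also have "\<dots> = (\<integral>z. (\<Sum>k=1..m. (4 ^ k / 8) * indicator (B k) z) \<partial>lborel)"
    by (subst Bochner_Integration.integral_sum) auto
  also have "\<dots> \<le> (\<integral>z. ?u z \<partial>lborel)"
    by (intro integral_mono int pt) auto
  finally show ?thesis .
qed

text \<open>W is chosen before m whereas the variation grows linearly in m: this is the failure of
  the L^1 estimate. S may depend on m, because the lattice of small copies will bring it
  down.\<close>

lemma basic_packet:
  obtains W where "W \<ge> 0" "\<And>m. \<exists>S \<rho> w \<phi> \<psi>. packet (cball 0 2) S W (real m / 32) \<rho> w \<phi> \<psi>"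
proof -
  obtain L where L: "L > 0" "\<And>t. \<bar>directional_deriv 1 smooth_step t\<bar> \<le> L * indicator {..1} t"
    using smooth_step_deriv_bound by blast
  have "\<exists>S \<rho> w \<phi> \<psi>. packet (cball 0 2) S (4 * L * pi) (real m / 32) \<rho> w \<phi> \<psi>" for m
  proof -
    \<comment> \<open>1/R is the lower end of the range on which
      \<open>dipole_pairing_lower_bound\<close> requires g(t) = 1/t.\<close>
    define R :: real where "R = 4 ^ (m + 1)"
    have R: "R \<ge> 4" by (simp add: R_def)
    define g where "g = ring_profile R 1"
    \<comment> \<open>A wider profile: it equals 1/t on [1/(4R), 2], a neighbourhood of the support
      of \<open>g\<close>, so the test field is exactly z_1 z / |z|^2 where it meets \<rho>. It
      vanishes for t \<ge> 4, whence the radius 2 of the packet.\<close>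
    define k where "k = ring_profile (4 * R) (1/4)"
    define \<rho> w \<phi> \<psi> :: "real^2 \<Rightarrow> real" where
      "\<rho> = (\<lambda>z. z$1 * g (z \<bullet> z))" and "w = (\<lambda>z. 2 * (g (z \<bullet> z) + (z \<bullet> z) * directional_deriv 1 g (z \<bullet> z)))" and
      "\<phi> = (\<lambda>z. z$1 * (z$1 * k (z \<bullet> z)))" and "\<psi> = (\<lambda>z. z$1 * (z$2 * k (z \<bullet> z)))"
    have smooth: "C_infinity g" "C_infinity k"
      using R by (auto simp: g_def k_def intro!: C_infinity_ring_profile)
    have C: "C_infinity \<rho>" "C_infinity w" "C_infinity \<phi>" "C_infinity \<psi>"
      unfolding \<rho>_def w_def \<phi>_def \<psi>_def
      by (intro C_infinity_dipole smooth C_infinity_mult C_infinity_coord C_infinity_radial)+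
    have w: "w z = 2 * (R * directional_deriv 1 smooth_step (R * (z \<bullet> z)) - directional_deriv 1 smooth_step (z \<bullet> z))" for z
    proof -
      define t where "t = z \<bullet> z"
      have "((\<lambda>t. t * g t) has_real_derivative (g t + t * directional_deriv 1 g t)) (at t)"
        using C_infinity_has_real_derivative[OF smooth(1)] by (auto intro!: derivative_eq_intros)
      moreover have "(\<lambda>t. t * g t) = (\<lambda>t. smooth_step (R * t) - smooth_step (1 * t))"
        using R by (auto simp: g_def ring_profile_times)
      moreover have "((\<lambda>t. smooth_step (R * t) - smooth_step (1 * t)) has_real_derivative
          (R * directional_deriv 1 smooth_step (R * t) - directional_deriv 1 smooth_step t)) (at t)"
        using DERIV_diff[OF DERIV_chain2[OF C_infinity_has_real_derivative[OF C_infinity_smooth_step] DERIV_cmult_Id[of R]]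
          C_infinity_has_real_derivative[OF C_infinity_smooth_step], of t] by (simp add: mult.commute)
      ultimately have "g t + t * directional_deriv 1 g t = R * directional_deriv 1 smooth_step (R * t) - directional_deriv 1 smooth_step t"
        using DERIV_unique by metis
      then show ?thesis by (simp add: w_def t_def)
    qed
    have w_le: "\<bar>w z\<bar> \<le> 2 * L * (R * indicator (cball 0 (1 / sqrt R)) z + indicator (cball 0 1) z)" for z
    proof -
      have 1: "z \<in> cball 0 (1 / sqrt R) \<longleftrightarrow> R * (z \<bullet> z) \<in> {..1}"
      proof -
        have "norm z \<le> 1 / sqrt R \<longleftrightarrow> (norm z)\<^sup>2 \<le> (1 / sqrt R)\<^sup>2"
          using R by (simp add: abs_le_square_iff[symmetric])
        then show ?thesis using R by (simp add: power_divide dot_square_norm field_simps)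
      qed
      have 2: "z \<in> cball 0 1 \<longleftrightarrow> z \<bullet> z \<in> {..1}"
        by (simp add: dot_square_norm power_le_one_iff abs_square_le_1)
      have "\<bar>w z\<bar> \<le> 2 * (R * \<bar>directional_deriv 1 smooth_step (R * (z \<bullet> z))\<bar> + \<bar>directional_deriv 1 smooth_step (z \<bullet> z)\<bar>)"
        using R unfolding w by (auto simp: abs_mult intro!: order_trans[OF abs_triangle_ineq4])
      also have "\<dots> \<le> 2 * (R * (L * indicator {..1} (R * (z \<bullet> z))) + L * indicator {..1} (z \<bullet> z))"
        using R by (intro mult_left_mono add_mono L(2)) auto
      also have "\<dots> = 2 * L * (R * indicator (cball 0 (1 / sqrt R)) z + indicator (cball 0 1) z)"
        using 1 2 by (simp add: indicator_def algebra_simps)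
      finally show ?thesis .
    qed
    have supp: "\<rho> z = 0 \<and> w z = 0 \<and> \<phi> z = 0 \<and> \<psi> z = 0" if "z \<notin> cball 0 2" for z
    proof -
      have "norm z > 2" using that by simp
      then have "z \<bullet> z > 2\<^sup>2" unfolding dot_square_norm by (intro power_strict_mono) auto
      then have "z \<bullet> z > 4" by simp
      then have "g (z \<bullet> z) = 0" "k (z \<bullet> z) = 0"
        using R by (auto simp: g_def k_def intro!: ring_profile_large)
      moreover have "w z = 0"
      proof -
        have "R * (z \<bullet> z) > 1" using R \<open>z \<bullet> z > 4\<close> mult_mono[of 4 R 1 "z \<bullet> z"] by simp
        then have "directional_deriv 1 smooth_step (R * (z \<bullet> z)) = 0" "directional_deriv 1 smooth_step (z \<bullet> z) = 0"
          using L(2)[of "R * (z \<bullet> z)"] L(2)[of "z \<bullet> z"] \<open>z \<bullet> z > 4\<close> by auto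
        then show ?thesis by (simp add: w)
      qed
      ultimately show ?thesis by (simp add: \<rho>_def \<phi>_def \<psi>_def)
    qed
    have cs: "compactly_supported \<rho>" "compactly_supported w" "compactly_supported \<phi>" "compactly_supported \<psi>"
      using supp by (auto intro!: compactly_supportedI[OF compact_cball[of 0 2]])
    obtain S where S: "\<And>z. \<bar>\<rho> z\<bar> \<le> S"
      using bounded_compactly_supported[OF C_infinity_continuous[OF C(1)] cs(1)] by (metis real_norm_def)
    have coord: "\<bar>z$1 * (z$i * k (z \<bullet> z))\<bar> \<le> 1" for z :: "real^2" and i
    proof -
      have "\<bar>z$1\<bar> * \<bar>z$i\<bar> \<le> norm z * norm z"
        by (intro mult_mono component_le_norm_cart) auto
      then have "\<bar>z$1 * z$i\<bar> \<le> \<bar>z \<bullet> z\<bar>" by (simp add: abs_mult dot_square_norm power2_eq_square)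
      then have "\<bar>z$1 * z$i\<bar> * \<bar>k (z \<bullet> z)\<bar> \<le> \<bar>z \<bullet> z\<bar> * \<bar>k (z \<bullet> z)\<bar>" by (rule mult_right_mono) simp
      also have "\<dots> \<le> 1"
        using ring_profile_times_abs_le[of "1/4" "4 * R" "z \<bullet> z"] R by (simp add: k_def abs_mult)
      finally show ?thesis by (simp add: abs_mult mult.assoc)
    qed
    have intw: "(\<integral>z. \<bar>w z\<bar> \<partial>lborel) \<le> 4 * L * pi"
    proof -
      have ind: "integrable lborel (\<lambda>z::real^2. indicator (cball 0 r) z :: real)" for r
        using emeasure_compact_finite[OF compact_cball] by (intro integrable_real_indicator) auto
      have "(\<integral>z. \<bar>w z\<bar> \<partial>lborel)
          \<le> (\<integral>z. 2 * L * (R * indicator (cball (0::real^2) (1 / sqrt R)) z + indicator (cball 0 1) z) \<partial>lborel)"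
      proof (rule integral_mono)
        show "integrable lborel (\<lambda>z. \<bar>w z\<bar>)"
          using integrable_compactly_supported[OF C_infinity_continuous[OF C(2)] cs(2)] by (rule integrable_abs)
      qed (intro ind w_le integrable_mult_right Bochner_Integration.integrable_add)+
      also have "\<dots> = 2 * L * (R * measure lborel (cball (0::real^2) (1 / sqrt R)) + measure lborel (cball (0::real^2) 1))"
        by (simp add: ind)
      \<comment> \<open>The amplitude R of the inner cutoff cancels against the area pi / R of its
        disc, so no dependence on m remains.\<close>
      also have "\<dots> = 4 * L * pi"
        using R by (simp add: measure_cball_2 power_divide)
      finally show ?thesis .
    qed
    have div: "\<rho> z * (directional_deriv e1 \<phi> z + directional_deriv e2 \<psi> z) = (z$1)\<^sup>2 * g (z \<bullet> z) / (z \<bullet> z)" for z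
      unfolding \<rho>_def \<phi>_def \<psi>_def
    proof (rule dipole_divergence[OF smooth(2), where U="{1 / (4 * R) <..<2}"])
      assume "g (z \<bullet> z) \<noteq> 0"
      then have "R * (z \<bullet> z) > 1/2" "z \<bullet> z < 1"
        using ring_profile_small[of 1 R "z \<bullet> z"] ring_profile_large[of 1 R "z \<bullet> z"] R
        unfolding g_def by (auto simp: not_le[symmetric])
      then have "z \<bullet> z \<in> {1 / (4 * R) <..<2}" using R by (auto simp: field_simps)
      moreover have "t \<noteq> 0 \<and> k t = inverse t" if t: "t \<in> {1 / (4 * R) <..<2}" for t
      proof -
        have "4 * R * t \<ge> 1" using t R by (auto simp: field_simps)
        then show ?thesis using t R unfolding k_def by (auto intro!: ring_profile_eq)
      qed
      ultimately show "open {1 / (4 * R) <..<2} \<and> z \<bullet> z \<in> {1 / (4 * R) <..<2} \<and>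
          (\<forall>t\<in>{1 / (4 * R) <..<2}. t \<noteq> 0 \<and> k t = inverse t)" by auto
    qed
    have "real m / 32 \<le> (\<integral>z. \<rho> z * (directional_deriv e1 \<phi> z + directional_deriv e2 \<psi> z) \<partial>lborel)"
      unfolding div
    proof (rule dipole_pairing_lower_bound)
      show "g t \<ge> 0" for t using R by (auto simp: g_def intro!: ring_profile_nonneg)
      show "g t = inverse t" if "1 / 4 ^ (m + 1) \<le> t" "t \<le> 1/2" for t
      proof -
        have "R * t \<ge> 1" using that(1) by (simp add: R_def field_simps)
        then show ?thesis using that(2) R unfolding g_def by (intro ring_profile_eq) auto
      qed
      have "integrable lborel (\<lambda>z. \<rho> z * (directional_deriv e1 \<phi> z + directional_deriv e2 \<psi> z))"
        using C cs by (auto simp: distrib_left test_functions_def intro!: Bochner_Integration.integrable_add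
            integrable_mult_test test_functions_directional C_infinity_continuous)
      then show "integrable lborel (\<lambda>z::real^2. (z$1)\<^sup>2 * g (z \<bullet> z) / (z \<bullet> z))"
        by (simp only: div)
    qed
    then have "packet (cball 0 2) S (4 * L * pi) (real m / 32) \<rho> w \<phi> \<psi>"
      unfolding packet_def using C supp S intw coord laplacian_dipole[OF smooth(1)]
      by (auto simp: \<rho>_def w_def \<phi>_def \<psi>_def)
    then show ?thesis by blast
  qed
  moreover have "4 * L * pi \<ge> 0" using L by simp
  ultimately show ?thesis using that by blast
qed

section \<open>Rescaling and superposing packets\<close>

lemma C_infinity_rescale:
  fixes f :: "'a::euclidean_space \<Rightarrow> 'b::real_normed_vector"
  assumes "C_infinity f"
  shows "C_infinity (\<lambda>z. f ((z - c) /\<^sub>R s))"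
  by (rule C_infinity_compose[OF assms C_infinity_scaleR[OF C_infinity_const C_infinity_diff[OF C_infinity_ident C_infinity_const]]])

lemma directional_deriv_rescale:
  fixes f :: "'a::euclidean_space \<Rightarrow> real"
  assumes "C_infinity f"
  shows "directional_deriv v (\<lambda>z. b * f ((z - c) /\<^sub>R s)) z = (b / s) * directional_deriv v f ((z - c) /\<^sub>R s)"
proof -
  have "((\<lambda>z. (z - c) /\<^sub>R s) has_derivative (\<lambda>v. v /\<^sub>R s)) (at z)"
    by (auto intro!: derivative_eq_intros)
  from has_derivative_mult_right[OF has_derivative_compose[OF this C_infinity_has_derivative[OF assms]], of b]
  have "directional_deriv v (\<lambda>z. b * f ((z - c) /\<^sub>R s)) z = b * directional_deriv (v /\<^sub>R s) f ((z - c) /\<^sub>R s)"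
    by (rule directional_deriv_eqI)
  also have "directional_deriv (v /\<^sub>R s) f ((z - c) /\<^sub>R s) = directional_deriv v f ((z - c) /\<^sub>R s) /\<^sub>R s"
    by (rule linear_cmul[OF has_derivative_linear[OF C_infinity_has_derivative[OF assms]]])
  finally show ?thesis by (simp add: divide_inverse)
qed

lemma directional_deriv_sum:
  assumes "\<And>i. i \<in> I \<Longrightarrow> C_infinity (f i)"
  shows "directional_deriv v (\<lambda>z. \<Sum>i\<in>I. f i z) z = (\<Sum>i\<in>I. directional_deriv v (f i) z)"
  by (rule directional_deriv_eqI) (intro has_derivative_sum C_infinity_has_derivative assms)

lemma packet_mono:
  assumes "packet K S W T \<rho> w \<phi> \<psi>" "K \<subseteq> K'" "S \<le> S'" "W \<le> W'" "T' \<le> T"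
  shows "packet K' S' W' T' \<rho> w \<phi> \<psi>"
  using assms unfolding packet_def by (blast intro: order_trans)

text \<open>The Laplacian of \<rho> gains s^-2 and a first derivative s^-1, so w has to gain a / s;
  areas scale by s^2. Hence the norm of w and the pairing both scale by a s, the supremum of \<rho>
  by a alone. The factors 1 bring the test field into the form of
  \<open>directional_deriv_rescale\<close>.\<close>

lemma packet_rescale:
  assumes p: "packet (cball 0 d) S W T \<rho> w \<phi> \<psi>" and s: "s > 0" and a: "a \<ge> 0"
  shows "packet (cball c (s * d)) (a * S) (a * s * W) (a * s * T)
    (\<lambda>z. a * \<rho> ((z - c) /\<^sub>R s)) (\<lambda>z. (a / s) * w ((z - c) /\<^sub>R s))
    (\<lambda>z. 1 * \<phi> ((z - c) /\<^sub>R s)) (\<lambda>z. 1 * \<psi> ((z - c) /\<^sub>R s))"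
proof -
  have C: "C_infinity \<rho>" "C_infinity w" "C_infinity \<phi>" "C_infinity \<psi>"
    using p by (auto simp: packet_def)
  have supp: "(z - c) /\<^sub>R s \<notin> cball 0 d" if "z \<notin> cball c (s * d)" for z
    proof -
    have "norm ((z - c) /\<^sub>R s) = norm (z - c) / s" using s by (simp add: divide_inverse)
    then show ?thesis using that s by (simp add: dist_norm norm_minus_commute pos_divide_le_eq mult.commute)
  qed
  have [measurable]: "w \<in> borel_measurable borel" "\<rho> \<in> borel_measurable borel"
    "directional_deriv v \<phi> \<in> borel_measurable borel" "directional_deriv v \<psi> \<in> borel_measurable borel" for v
    using C by (auto intro!: borel_measurable_continuous C_infinity_continuous C_infinity_directional)
  have lap: "laplacian (\<lambda>z. a * \<rho> ((z - c) /\<^sub>R s)) z = directional_deriv e1 (\<lambda>z. (a / s) * w ((z - c) /\<^sub>R s)) z" for z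
  proof -
    have D: "directional_deriv v (\<lambda>z. a * \<rho> ((z - c) /\<^sub>R s)) = (\<lambda>z. (a / s) * directional_deriv v \<rho> ((z - c) /\<^sub>R s))" for v
      using C by (intro ext directional_deriv_rescale)
    have "laplacian (\<lambda>z. a * \<rho> ((z - c) /\<^sub>R s)) z = (a / s / s) * laplacian \<rho> ((z - c) /\<^sub>R s)"
      unfolding laplacian_2 D directional_deriv_rescale[OF C_infinity_directional[OF C(1)]]
      by (simp add: distrib_left)
    then show ?thesis using p unfolding directional_deriv_rescale[OF C(2)] by (simp add: packet_def)
  qed
  have "(\<integral>z. \<bar>(a / s) * w ((z - c) /\<^sub>R s)\<bar> \<partial>lborel) = a * s * (\<integral>z. \<bar>w z\<bar> \<partial>lborel)"
    using integral_lborel_rescale[of "\<lambda>z. \<bar>w z\<bar>" s c] s a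
    by (simp add: abs_mult power2_eq_square)
  also have "\<dots> \<le> a * s * W"
    using p s a by (intro mult_left_mono) (auto simp: packet_def)
  finally have W: "(\<integral>z. \<bar>(a / s) * w ((z - c) /\<^sub>R s)\<bar> \<partial>lborel) \<le> a * s * W" .
  let ?q = "\<lambda>z. \<rho> z * (directional_deriv e1 \<phi> z + directional_deriv e2 \<psi> z)"
  have "a * s * T \<le> a * s * integral\<^sup>L lborel ?q"
    using p s a by (intro mult_left_mono) (auto simp: packet_def)
  also have "\<dots> = (a / s) * (\<integral>z. ?q ((z - c) /\<^sub>R s) \<partial>lborel)"
    using integral_lborel_rescale[of ?q s c] s by (simp add: power2_eq_square)
  also have "\<dots> = (\<integral>z. (a / s) * ?q ((z - c) /\<^sub>R s) \<partial>lborel)" by simp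
  also have "\<dots> = (\<integral>z. a * \<rho> ((z - c) /\<^sub>R s) * (directional_deriv e1 (\<lambda>z. 1 * \<phi> ((z - c) /\<^sub>R s)) z +
      directional_deriv e2 (\<lambda>z. 1 * \<psi> ((z - c) /\<^sub>R s)) z) \<partial>lborel)"
    unfolding directional_deriv_rescale[OF C(3)] directional_deriv_rescale[OF C(4)]
    using s by (intro Bochner_Integration.integral_cong refl) (simp add: field_simps)
  finally have T: "a * s * T \<le> \<dots>" .
  have b1: "\<bar>a * \<rho> ((z - c) /\<^sub>R s)\<bar> \<le> a * S" for z
    using p a by (simp add: abs_mult packet_def mult_left_mono)
  have b2: "\<bar>1 * \<phi> ((z - c) /\<^sub>R s)\<bar> \<le> 1" "\<bar>1 * \<psi> ((z - c) /\<^sub>R s)\<bar> \<le> 1" for z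
    using p by (simp_all add: packet_def)
  have z: "a * \<rho> ((z - c) /\<^sub>R s) = 0 \<and> (a / s) * w ((z - c) /\<^sub>R s) = 0 \<and>
      1 * \<phi> ((z - c) /\<^sub>R s) = 0 \<and> 1 * \<psi> ((z - c) /\<^sub>R s) = 0" if "z \<notin> cball c (s * d)" for z
    proof -
    have "\<forall>y. y \<notin> cball 0 d \<longrightarrow> \<rho> y = 0 \<and> w y = 0 \<and> \<phi> y = 0 \<and> \<psi> y = 0"
      using p unfolding packet_def by (elim conjE)
    from this[rule_format, OF supp[OF that]] show ?thesis by simp
  qed
  have Cr: "C_infinity (\<lambda>z. b * f ((z - c) /\<^sub>R s))" if "C_infinity f" for b and f :: "real^2 \<Rightarrow> real"
    by (intro C_infinity_mult C_infinity_const C_infinity_rescale that)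
  show ?thesis
    unfolding packet_def
    by (intro conjI allI impI Cr[OF C(1)] Cr[OF C(2)] Cr[OF C(3)] Cr[OF C(4)] b1 b2 lap W T;
        drule z, elim conjE, assumption)
qed

lemma abs_sum_disjoint_le:
  fixes f :: "'i \<Rightarrow> 'a \<Rightarrow> real"
  assumes "finite I" "disjoint_family_on K I" "\<And>i. i \<in> I \<Longrightarrow> z \<notin> K i \<Longrightarrow> f i z = 0"
    "\<And>i. i \<in> I \<Longrightarrow> \<bar>f i z\<bar> \<le> S" "S \<ge> 0"
  shows "\<bar>\<Sum>i\<in>I. f i z\<bar> \<le> S"
proof (cases "\<exists>i\<in>I. z \<in> K i")
  case True
  then obtain i where i: "i \<in> I" "z \<in> K i" by auto
  have "(\<Sum>i\<in>I. f i z) = (\<Sum>j\<in>{i}. f j z)"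
    using i assms by (intro sum.mono_neutral_right) (auto simp: disjoint_family_on_def)
  then show ?thesis using assms i by simp
next
  case False
  then show ?thesis using assms by (simp add: sum.neutral)
qed

text \<open>At each point at most one term is nonzero, so the supremum bounds do not accumulate,
  while W and T do. Since the \<open>K i\<close> are closed, derivatives vanish outside them too,
  which removes the cross terms from the pairing.\<close>

lemma packet_sum:
  assumes "finite I" "disjoint_family_on K I" "\<And>i. i \<in> I \<Longrightarrow> closed (K i)" and K: "\<And>i. i \<in> I \<Longrightarrow> K i \<subseteq> cball c r"
    and p: "\<And>i. i \<in> I \<Longrightarrow> packet (K i) S W T (\<rho> i) (w i) (\<phi> i) (\<psi> i)" and "S \<ge> 0"
  shows "packet (cball c r) S (real (card I) * W) (real (card I) * T)
    (\<lambda>z. \<Sum>i\<in>I. \<rho> i z) (\<lambda>z. \<Sum>i\<in>I. w i z) (\<lambda>z. \<Sum>i\<in>I. \<phi> i z) (\<lambda>z. \<Sum>i\<in>I. \<psi> i z)"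
proof -
  have C: "C_infinity (\<rho> i)" "C_infinity (w i)" "C_infinity (\<phi> i)" "C_infinity (\<psi> i)" if "i \<in> I" for i
    using p[OF that] by (auto simp: packet_def)
  have zero: "\<rho> i z = 0" "w i z = 0" "\<phi> i z = 0" "\<psi> i z = 0" if "i \<in> I" "z \<notin> K i" for i z
    using p[OF that(1)] that(2) by (auto simp: packet_def)
  have zeroD: "directional_deriv v (\<phi> i) z = 0" "directional_deriv v (\<psi> i) z = 0" if "i \<in> I" "z \<notin> K i" for i z v
    using directional_deriv_zero_outside[of "K i"] zero(3,4) that assms(3) by blast+
  have cs: "compactly_supported (w i)" "\<phi> i \<in> test_functions" "\<psi> i \<in> test_functions" if "i \<in> I" for i
  proof -
    have "w i z = 0 \<and> \<phi> i z = 0 \<and> \<psi> i z = 0" if "z \<notin> cball c r" for z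
      using zero \<open>i \<in> I\<close> K that by blast
    then show "compactly_supported (w i)" "\<phi> i \<in> test_functions" "\<psi> i \<in> test_functions"
      using C that by (auto simp: test_functions_def intro!: compactly_supportedI[OF compact_cball[of c r]])
  qed
  have D: "directional_deriv v (\<lambda>z. \<Sum>i\<in>I. f i z) = (\<lambda>z. \<Sum>i\<in>I. directional_deriv v (f i) z)"
    if "\<And>i. i \<in> I \<Longrightarrow> C_infinity (f i)" for v and f :: "_ \<Rightarrow> real^2 \<Rightarrow> real"
    using that by (intro ext directional_deriv_sum)
  have lap: "laplacian (\<lambda>z. \<Sum>i\<in>I. \<rho> i z) z = directional_deriv e1 (\<lambda>z. \<Sum>i\<in>I. w i z) z" for z
  proof -
    have "laplacian (\<lambda>z. \<Sum>i\<in>I. \<rho> i z) z = (\<Sum>i\<in>I. laplacian (\<rho> i) z)"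
      by (simp add: laplacian_2 D C C_infinity_directional sum.distrib)
    also have "\<dots> = (\<Sum>i\<in>I. directional_deriv e1 (w i) z)"
      using p by (intro sum.cong) (auto simp: packet_def)
    finally show ?thesis by (simp add: D C)
  qed
  have iw: "integrable lborel (w i)" if "i \<in> I" for i
    using C cs that by (intro integrable_compactly_supported C_infinity_continuous) auto
  have "(\<integral>z. \<bar>\<Sum>i\<in>I. w i z\<bar> \<partial>lborel) \<le> (\<integral>z. (\<Sum>i\<in>I. \<bar>w i z\<bar>) \<partial>lborel)"
    by (intro integral_mono integrable_abs Bochner_Integration.integrable_sum iw sum_abs)
  also have "\<dots> = (\<Sum>i\<in>I. \<integral>z. \<bar>w i z\<bar> \<partial>lborel)"
    by (intro Bochner_Integration.integral_sum integrable_abs iw)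
  also have "\<dots> \<le> real (card I) * W"
    using p by (intro sum_bounded_above) (auto simp: packet_def)
  finally have W: "(\<integral>z. \<bar>\<Sum>i\<in>I. w i z\<bar> \<partial>lborel) \<le> real (card I) * W" .
  let ?q = "\<lambda>i z. \<rho> i z * (directional_deriv e1 (\<phi> i) z + directional_deriv e2 (\<psi> i) z)"
  have iq: "integrable lborel (?q i)" if "i \<in> I" for i
    using C[OF that] cs[OF that] by (auto simp: distrib_left intro!: Bochner_Integration.integrable_add
        integrable_mult_test test_functions_directional C_infinity_continuous)
  have q: "(\<Sum>i\<in>I. \<rho> i z) * ((\<Sum>i\<in>I. directional_deriv e1 (\<phi> i) z) + (\<Sum>i\<in>I. directional_deriv e2 (\<psi> i) z)) = (\<Sum>i\<in>I. ?q i z)" for z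
  proof -
    have cross: "\<rho> i z * (directional_deriv e1 (\<phi> j) z + directional_deriv e2 (\<psi> j) z) = (if j = i then ?q i z else 0)"
      if "i \<in> I" "j \<in> I" for i j
    proof (cases "z \<in> K i \<and> i \<noteq> j")
      case True
      then have "z \<notin> K j" using assms(2) that by (auto simp: disjoint_family_on_def)
      then show ?thesis using zeroD that True by auto
    next
      case False
      then show ?thesis using zero that by auto
    qed
    have "(\<Sum>i\<in>I. \<rho> i z) * ((\<Sum>i\<in>I. directional_deriv e1 (\<phi> i) z) + (\<Sum>i\<in>I. directional_deriv e2 (\<psi> i) z))
        = (\<Sum>i\<in>I. \<Sum>j\<in>I. \<rho> i z * (directional_deriv e1 (\<phi> j) z + directional_deriv e2 (\<psi> j) z))"
      by (simp only: sum.distrib[symmetric] sum_product)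
    also have "\<dots> = (\<Sum>i\<in>I. \<Sum>j\<in>I. if j = i then ?q i z else 0)"
      by (intro sum.cong refl cross)
    also have "\<dots> = (\<Sum>i\<in>I. ?q i z)"
      using assms(1) by (intro sum.cong refl) (simp only: sum.delta if_True)
    finally show ?thesis .
  qed
  have "real (card I) * T \<le> (\<Sum>i\<in>I. integral\<^sup>L lborel (?q i))"
    using p by (intro sum_bounded_below) (auto simp: packet_def)
  also have "\<dots> = (\<integral>z. (\<Sum>i\<in>I. ?q i z) \<partial>lborel)"
    using iq by (intro Bochner_Integration.integral_sum[symmetric])
  also have "\<dots> = (\<integral>z. (\<Sum>i\<in>I. \<rho> i z) * (directional_deriv e1 (\<lambda>z. \<Sum>i\<in>I. \<phi> i z) z + directional_deriv e2 (\<lambda>z. \<Sum>i\<in>I. \<psi> i z) z) \<partial>lborel)"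
    by (simp only: D C q)
  finally have T: "real (card I) * T \<le> \<dots>" .
  have b: "\<bar>\<Sum>i\<in>I. \<rho> i z\<bar> \<le> S" "\<bar>\<Sum>i\<in>I. \<phi> i z\<bar> \<le> 1" "\<bar>\<Sum>i\<in>I. \<psi> i z\<bar> \<le> 1" for z
    using p zero \<open>S \<ge> 0\<close> by (intro abs_sum_disjoint_le[OF assms(1,2)]; auto simp: packet_def)+
  have "(\<Sum>i\<in>I. \<rho> i z) = 0 \<and> (\<Sum>i\<in>I. w i z) = 0 \<and> (\<Sum>i\<in>I. \<phi> i z) = 0 \<and> (\<Sum>i\<in>I. \<psi> i z) = 0" if "z \<notin> cball c r" for z
    using zero K that by (intro conjI sum.neutral ballI) blast+
  then show ?thesis
    unfolding packet_def using lap W T b C by (intro conjI allI impI C_infinity_sum) auto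
qed

text \<open>An \<open>N \<times> N\<close> lattice of copies scaled down by \<open>1/N\<close> keeps the norms of \<open>w\<close> and of the gradient
  comparable, while the supremum of \<open>\<rho>\<close> decays like \<open>1/N\<close>.\<close>

lemma packet_exists:
  assumes "r > 0" "\<epsilon> > 0"
  shows "\<exists>\<rho> w \<phi> \<psi>. packet (cball c r) \<epsilon> \<epsilon> M \<rho> w \<phi> \<psi>"
proof -
  obtain W where W: "W \<ge> 0" "\<And>m. \<exists>S \<rho> w \<phi> \<psi>. packet (cball 0 2) S W (real m / 32) \<rho> w \<phi> \<psi>"
    using basic_packet by blast
  \<comment> \<open>After summation the pairing is at least \<epsilon> m / (32 (W + 1)), and this
    has to reach M.\<close>
  obtain m :: nat where m: "real m \<ge> M * 32 * (W + 1) / \<epsilon>"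
    using real_arch_simple by blast
  obtain S \<rho> w \<phi> \<psi> where p: "packet (cball 0 2) S W (real m / 32) \<rho> w \<phi> \<psi>"
    using W(2) by blast
  have S: "S \<ge> 0" using p unfolding packet_def by (meson abs_ge_zero order_trans)
  obtain N0 :: nat where N0: "real N0 \<ge> 10 * S / r"
    using real_arch_simple by blast
  define N where "N = N0 + 1"
  have N: "N \<ge> 1" "real N \<ge> 10 * S / r" using N0 by (auto simp: N_def)
  \<comment> \<open>Centres at least 5s apart keep discs of radius 2s disjoint; the lattice stays
    within 10 s (N - 1) = r - 10 s of c, which leaves room for the outermost discs. The amplitude
    solves N^2 a s = \<epsilon> / (W + 1), with W + 1 excluding a division by 0. It is of order 1/N,
    and the lower bound on N yields a S \<le> \<epsilon>.\<close>
  define s where "s = r / (10 * real N)"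
  define a where "a = \<epsilon> / (s * (real N)\<^sup>2 * (W + 1))"
  define x where "x = (\<lambda>ij::nat \<times> nat. c + (5 * s) *\<^sub>R (real (fst ij) *\<^sub>R e1 + real (snd ij) *\<^sub>R e2))"
  define I where "I = {..<N} \<times> {..<N}"
  have s: "s > 0" using assms N by (simp add: s_def)
  have a: "a > 0" using assms N s W by (auto simp: a_def intro!: divide_pos_pos mult_pos_pos)
  have x1: "x ij $ 1 = c $ 1 + 5 * s * real (fst ij)" and x2: "x ij $ 2 = c $ 2 + 5 * s * real (snd ij)" for ij
    by (simp_all add: x_def axis_def)
  have "packet (cball c r) (a * S) (real (card I) * (a * s * W)) (real (card I) * (a * s * (real m / 32)))
    (\<lambda>z. \<Sum>i\<in>I. a * \<rho> ((z - x i) /\<^sub>R s)) (\<lambda>z. \<Sum>i\<in>I. (a / s) * w ((z - x i) /\<^sub>R s))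
    (\<lambda>z. \<Sum>i\<in>I. 1 * \<phi> ((z - x i) /\<^sub>R s)) (\<lambda>z. \<Sum>i\<in>I. 1 * \<psi> ((z - x i) /\<^sub>R s))"
  proof (rule packet_sum[where K = "\<lambda>i. cball (x i) (s * 2)"])
    show "disjoint_family_on (\<lambda>i. cball (x i) (s * 2)) I"
      unfolding disjoint_family_on_def
    proof (intro ballI impI)
      fix i j assume "i \<in> I" "j \<in> I" "i \<noteq> j"
      have far: "5 * s \<le> \<bar>5 * s * real k - 5 * s * real l\<bar>" if "k \<noteq> l" for k l :: nat
      proof -
        have "1 \<le> \<bar>real k - real l\<bar>" using that by linarith
        then have "5 * s * 1 \<le> 5 * s * \<bar>real k - real l\<bar>" using s by (intro mult_left_mono) auto
        then show ?thesis using s by (simp add: abs_mult right_diff_distrib[symmetric])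
      qed
      have "5 * s \<le> norm (x i - x j)"
      proof (cases "fst i = fst j")
        case True
        then have "5 * s \<le> \<bar>(x i - x j) $ 2\<bar>"
          using far[of "snd i" "snd j"] \<open>i \<noteq> j\<close> by (simp add: x2 prod_eq_iff)
        then show ?thesis using component_le_norm_cart[of "x i - x j" 2] by linarith
      next
        case False
        then have "5 * s \<le> \<bar>(x i - x j) $ 1\<bar>" using far[of "fst i" "fst j"] by (simp add: x1)
        then show ?thesis using component_le_norm_cart[of "x i - x j" 1] by linarith
      qed
      then have "dist (x i) (x j) > s * 2 + s * 2" using s by (simp add: dist_norm)
      then show "cball (x i) (s * 2) \<inter> cball (x j) (s * 2) = {}"
        by (rule disjoint_cballI)
    qed
    show "cball (x i) (s * 2) \<subseteq> cball c r" if "i \<in> I" for i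
    proof -
      have "norm (real (fst i) *\<^sub>R e1 + real (snd i) *\<^sub>R e2) \<le> real (fst i) + real (snd i)"
        by (rule order_trans[OF norm_triangle_ineq]) simp
      also have "\<dots> \<le> 2 * real N - 2" using that by (auto simp: I_def)
      finally have "5 * s * norm (real (fst i) *\<^sub>R e1 + real (snd i) *\<^sub>R e2) \<le> 5 * s * (2 * real N - 2)"
        using s by (intro mult_left_mono) auto
      then have "dist (x i) c \<le> 5 * s * (2 * real N - 2)" using s by (simp add: x_def dist_norm)
      moreover have "5 * s * (2 * real N - 2) = r - 10 * s"
        using N by (simp add: s_def field_simps)
      ultimately have "dist (x i) c + s * 2 \<le> r" using s by linarith
      then show ?thesis by (simp add: cball_subset_cball_iff)
    qed
    show "packet (cball (x i) (s * 2)) (a * S) (a * s * W) (a * s * (real m / 32))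
      (\<lambda>z. a * \<rho> ((z - x i) /\<^sub>R s)) (\<lambda>z. (a / s) * w ((z - x i) /\<^sub>R s))
      (\<lambda>z. 1 * \<phi> ((z - x i) /\<^sub>R s)) (\<lambda>z. 1 * \<psi> ((z - x i) /\<^sub>R s))" for i
      using packet_rescale[OF p s] a by simp
  qed (use S a in \<open>auto simp: I_def\<close>)
  then have "packet (cball c r) \<epsilon> \<epsilon> M
    (\<lambda>z. \<Sum>i\<in>I. a * \<rho> ((z - x i) /\<^sub>R s)) (\<lambda>z. \<Sum>i\<in>I. (a / s) * w ((z - x i) /\<^sub>R s))
    (\<lambda>z. \<Sum>i\<in>I. 1 * \<phi> ((z - x i) /\<^sub>R s)) (\<lambda>z. \<Sum>i\<in>I. 1 * \<psi> ((z - x i) /\<^sub>R s))"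
  proof (rule packet_mono)
    have cardI: "real (card I) = (real N)\<^sup>2" by (simp add: I_def card_cartesian_product power2_eq_square)
    have as: "real (card I) * (a * s * y) = \<epsilon> / (W + 1) * y" for y
      using N s W by (simp add: cardI a_def)
    have "a = 10 * \<epsilon> / (r * real N * (W + 1))"
      using N assms W by (simp add: a_def s_def power2_eq_square)
    moreover have "10 * S \<le> r * real N * (W + 1)"
    proof -
      have "10 * S \<le> r * real N" using N(2) assms by (simp add: field_simps)
      also have "\<dots> \<le> r * real N * (W + 1)" using assms W by (simp add: mult_left_mono algebra_simps)
      finally show ?thesis .
    qed
    moreover have "r * real N * (W + 1) > 0" using assms N W by simp
    ultimately show "a * S \<le> \<epsilon>" using assms by (simp add: pos_divide_le_eq mult_ac)
    show "real (card I) * (a * s * W) \<le> \<epsilon>"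
      unfolding as using W assms by (simp add: field_simps)
    show "M \<le> real (card I) * (a * s * (real m / 32))"
      unfolding as using m assms W by (simp add: field_simps)
  qed simp
  then show ?thesis by blast
qed

section \<open>Superposition over disjoint balls\<close>

text \<open>Bounding the two components separately instead of the norm of the field changes the
  variation by at most a constant factor and matches the bounds in \<open>packet\<close>.\<close>

definition unbounded_variation :: "(real^2 \<Rightarrow> real) \<Rightarrow> bool" where
  "unbounded_variation \<rho> \<longleftrightarrow> (\<forall>M. \<exists>\<phi>\<in>test_functions. \<exists>\<psi>\<in>test_functions.
     (\<forall>z. \<bar>\<phi> z\<bar> \<le> 1 \<and> \<bar>\<psi> z\<bar> \<le> 1) \<and>
     M \<le> (\<integral>z. \<rho> z * (directional_deriv e1 \<phi> z + directional_deriv e2 \<psi> z) \<partial>lborel))"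

section \<open>Pairings with test functions\<close>

lemma integrable_mult_bounded:
  fixes f \<phi> :: "'a::euclidean_space \<Rightarrow> real"
  assumes "integrable lborel f" "\<phi> \<in> borel_measurable borel" "\<And>z. \<bar>\<phi> z\<bar> \<le> B"
  shows "integrable lborel (\<lambda>z. f z * \<phi> z)"
    and "(\<integral>z. \<bar>f z * \<phi> z\<bar> \<partial>lborel) \<le> B * (\<integral>z. \<bar>f z\<bar> \<partial>lborel)"
proof -
  have le: "\<bar>f z * \<phi> z\<bar> \<le> B * \<bar>f z\<bar>" for z
    using mult_right_mono[OF assms(3)[of z], of "\<bar>f z\<bar>"] by (simp add: abs_mult mult.commute)
  show i: "integrable lborel (\<lambda>z. f z * \<phi> z)"
    using assms le
    by (intro Bochner_Integration.integrable_bound[OF integrable_mult_right[OF integrable_abs[OF assms(1)], of B]])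
       (auto intro!: borel_measurable_times order_trans[OF le abs_ge_self])
  have "(\<integral>z. \<bar>f z * \<phi> z\<bar> \<partial>lborel) \<le> (\<integral>z. B * \<bar>f z\<bar> \<partial>lborel)"
    using assms(1) by (intro integral_mono integrable_abs i le) auto
  then show "(\<integral>z. \<bar>f z * \<phi> z\<bar> \<partial>lborel) \<le> B * (\<integral>z. \<bar>f z\<bar> \<partial>lborel)" by simp
qed

lemma test_functions_continuous: "\<phi> \<in> test_functions \<Longrightarrow> continuous_on S \<phi>"
  by (simp add: test_functions_def C_infinity_continuous)

lemma C_infinity_gradient: "C_infinity f \<Longrightarrow> C_infinity (gradient f)"
  unfolding gradient_def [abs_def] by (intro C_infinity_sum C_infinity_scaleR C_infinity_directional C_infinity_const)

text \<open>Integration by parts and \<open>\<bar>\<eta> z\<bar> \<le> 1\<close>. It serves twice: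
  it limits what the background contributes to a pairing, and it refutes an integrable gradient of
  the density in (b).\<close>

lemma integral_directional_test_le:
  fixes f :: "'a::euclidean_space \<Rightarrow> real"
  assumes f: "C_infinity f" "integrable lborel (\<lambda>z. norm (gradient f z))"
    and v: "v \<in> Basis" and \<eta>: "\<eta> \<in> test_functions" "\<And>z. \<bar>\<eta> z\<bar> \<le> 1"
  shows "integrable lborel (\<lambda>z. f z * directional_deriv v \<eta> z)"
    and "\<bar>\<integral>z. f z * directional_deriv v \<eta> z \<partial>lborel\<bar> \<le> (\<integral>z. norm (gradient f z) \<partial>lborel)"
proof -
  show "integrable lborel (\<lambda>z. f z * directional_deriv v \<eta> z)"
    using f(1) \<eta> by (intro integrable_mult_test test_functions_directional C_infinity_continuous)
  have comp: "directional_deriv v f z = gradient f z \<bullet> v" for z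
    unfolding gradient_def using v by (simp add: inner_sum_left inner_Basis if_distrib cong: if_cong)
  have [measurable]: "directional_deriv v f \<in> borel_measurable borel"
    using f(1) by (intro borel_measurable_continuous C_infinity_continuous C_infinity_directional)
  have i: "integrable lborel (directional_deriv v f)"
    using v by (intro Bochner_Integration.integrable_bound[OF f(2)]) (auto simp: comp Basis_le_norm)
  have "\<bar>\<integral>z. f z * directional_deriv v \<eta> z \<partial>lborel\<bar> \<le> (\<integral>z. \<bar>directional_deriv v f z * \<eta> z\<bar> \<partial>lborel)"
    using integral_by_parts_test[OF f(1) \<eta>(1)] integral_norm_bound[of lborel "\<lambda>z. directional_deriv v f z * \<eta> z"] by simp
  also have "\<dots> \<le> 1 * (\<integral>z. \<bar>directional_deriv v f z\<bar> \<partial>lborel)"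
    using \<eta> by (intro integrable_mult_bounded(2) i borel_measurable_continuous test_functions_continuous)
  also have "\<dots> \<le> (\<integral>z. norm (gradient f z) \<partial>lborel)"
    unfolding mult_1 using v by (intro integral_mono integrable_abs i f(2)) (auto simp: comp Basis_le_norm)
  finally show "\<bar>\<integral>z. f z * directional_deriv v \<eta> z \<partial>lborel\<bar> \<le> (\<integral>z. norm (gradient f z) \<partial>lborel)" .
qed

lemma inner_gradient_2:
  "v \<bullet> gradient \<phi> z = v$1 * directional_deriv e1 \<phi> z + v$2 * directional_deriv e2 \<phi> z"
  by (simp add: gradient_2 inner_add_right inner_axis mult.commute)

lemma integral_laplacian_test:
  fixes f :: "real^2 \<Rightarrow> real"
  assumes f: "C_infinity f" and \<phi>: "\<phi> \<in> test_functions"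
  shows "integrable lborel (\<lambda>z. laplacian \<phi> z * f z)"
    and "(\<integral>z. laplacian \<phi> z * f z \<partial>lborel) =
      - (\<integral>z. directional_deriv e1 f z * directional_deriv e1 \<phi> z \<partial>lborel) -
        (\<integral>z. directional_deriv e2 f z * directional_deriv e2 \<phi> z \<partial>lborel)"
proof -
  have eq: "laplacian \<phi> z * f z = f z * directional_deriv e1 (directional_deriv e1 \<phi>) z +
      f z * directional_deriv e2 (directional_deriv e2 \<phi>) z" for z
    by (simp add: laplacian_2 algebra_simps)
  have i: "integrable lborel (\<lambda>z. f z * directional_deriv v (directional_deriv v \<phi>) z)" for v
    using f \<phi> by (intro integrable_mult_test test_functions_directional C_infinity_continuous)
  show "integrable lborel (\<lambda>z. laplacian \<phi> z * f z)"
    unfolding eq by (intro Bochner_Integration.integrable_add i)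
  show "(\<integral>z. laplacian \<phi> z * f z \<partial>lborel) =
      - (\<integral>z. directional_deriv e1 f z * directional_deriv e1 \<phi> z \<partial>lborel) -
        (\<integral>z. directional_deriv e2 f z * directional_deriv e2 \<phi> z \<partial>lborel)"
    unfolding eq using f \<phi>
    by (simp add: i integral_by_parts_test test_functions_directional)
qed

text \<open>Two integrations by parts move the Laplacian onto \<rho>, where it becomes the
  e1-derivative of w; a third moves this derivative back onto \<phi> and produces the sign that
  cancels the flux term.\<close>

lemma packet_weak:
  assumes p: "packet K S W T \<rho> w \<phi>' \<psi>'" and \<phi>: "\<phi> \<in> test_functions"
  shows "has_bochner_integral lborel (\<lambda>z. laplacian \<phi> z * \<rho> z + w z * directional_deriv e1 \<phi> z) 0"
proof -
  have C: "C_infinity \<rho>" "C_infinity w" using p by (auto simp: packet_def)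
  note D = test_functions_directional[OF \<phi>]
  have i: "integrable lborel (\<lambda>z. w z * directional_deriv e1 \<phi> z)"
    using C D by (intro integrable_mult_test C_infinity_continuous)
  have "(\<integral>z. laplacian \<phi> z * \<rho> z \<partial>lborel) =
      (\<integral>z. directional_deriv e1 (directional_deriv e1 \<rho>) z * \<phi> z \<partial>lborel) +
      (\<integral>z. directional_deriv e2 (directional_deriv e2 \<rho>) z * \<phi> z \<partial>lborel)"
    using C \<phi> by (simp add: integral_laplacian_test integral_by_parts_test C_infinity_directional)
  also have "\<dots> = (\<integral>z. directional_deriv e1 (directional_deriv e1 \<rho>) z * \<phi> z +
      directional_deriv e2 (directional_deriv e2 \<rho>) z * \<phi> z \<partial>lborel)"
    using C \<phi> by (intro Bochner_Integration.integral_add[symmetric] integrable_mult_test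
        C_infinity_continuous C_infinity_directional)
  also have "\<dots> = (\<integral>z. directional_deriv e1 w z * \<phi> z \<partial>lborel)"
    using p by (simp add: packet_def laplacian_2 distrib_right[symmetric])
  also have "\<dots> = - (\<integral>z. w z * directional_deriv e1 \<phi> z \<partial>lborel)"
    using C \<phi> by (simp add: integral_by_parts_test)
  finally show ?thesis
    using i integral_laplacian_test(1)[OF C(1) \<phi>] by (simp add: has_bochner_integral_iff)
qed

text \<open>The background balances its own diffusion by the flux \<open>gradient \<beta>\<close>,
  which is where that term of v comes from.\<close>

lemma gradient_weak:
  fixes \<beta> :: "real^2 \<Rightarrow> real"
  assumes \<beta>: "C_infinity \<beta>" and \<phi>: "\<phi> \<in> test_functions"
  shows "has_bochner_integral lborel (\<lambda>z. laplacian \<phi> z * \<beta> z + gradient \<beta> z \<bullet> gradient \<phi> z) 0"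
proof -
  have eq: "gradient \<beta> z \<bullet> gradient \<phi> z = directional_deriv e1 \<beta> z * directional_deriv e1 \<phi> z +
      directional_deriv e2 \<beta> z * directional_deriv e2 \<phi> z" for z
    by (simp add: inner_gradient_2) (simp add: gradient_2 axis_def)
  have i: "integrable lborel (\<lambda>z. directional_deriv v \<beta> z * directional_deriv v \<phi> z)" for v
    using \<beta> \<phi> by (intro integrable_mult_test test_functions_directional C_infinity_continuous C_infinity_directional)
  show ?thesis
    unfolding eq using i integral_laplacian_test[OF \<beta> \<phi>] by (simp add: has_bochner_integral_iff)
qed

text \<open>Pointwise at most one term is nonzero, so summability requires no decay.\<close>

lemma suminf_disjoint:
  fixes f :: "nat \<Rightarrow> 'a \<Rightarrow> real"
  assumes "disjoint_family K" "\<forall>n z. z \<notin> K n \<longrightarrow> f n z = 0"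
  shows "z \<in> K n \<Longrightarrow> (\<Sum>n. f n z) = f n z"
    and "(\<And>n. z \<notin> K n) \<Longrightarrow> (\<Sum>n. f n z) = 0"
    and "summable (\<lambda>n. norm (f n z))"
proof -
  have other: "f m z = 0" if "z \<in> K n" "m \<noteq> n" for m n
    using assms that unfolding disjoint_family_on_def by blast
  show "(\<Sum>n. f n z) = f n z" if "z \<in> K n"
    using suminf_finite[of "{n}" "\<lambda>n. f n z"] other[OF that] by simp
  show "(\<Sum>n. f n z) = 0" if "\<And>n. z \<notin> K n"
    using assms(2) that by simp
  show "summable (\<lambda>n. norm (f n z))"
  proof (cases "\<exists>n. z \<in> K n")
    case True
    then obtain n where "z \<in> K n" by auto
    then show ?thesis using other by (intro summable_finite[of "{n}"]) auto
  next
    case False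
    then show ?thesis using assms(2) by simp
  qed
qed

text \<open>The two-sided bound makes \<rho> vanish exactly where \<beta> does, which later allows
  division by \<rho>. Smoothness is stated as an implication so that one construction covers both
  examples: the discs are locally finite only in (b).\<close>

lemma packet_series:
  fixes \<beta> :: "real^2 \<Rightarrow> real" and c :: "nat \<Rightarrow> real^2" and r :: "nat \<Rightarrow> real"
  defines "K \<equiv> \<lambda>n. cball (c n) (r n)"
  assumes \<beta>: "C_infinity \<beta>" "\<And>z. 0 \<le> \<beta> z" "integrable lborel \<beta>" "integrable lborel (gradient \<beta>)"
    and disj: "disjoint_family K" and r: "\<And>n. r n > 0" and pos: "\<And>n z. z \<in> K n \<Longrightarrow> \<beta> z > 0"
  obtains \<rho> w where "continuous_on UNIV \<rho>" "\<And>z. \<beta> z / 2 \<le> \<rho> z" "\<And>z. \<rho> z \<le> 2 * \<beta> z"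
    "w \<in> borel_measurable borel" "integrable lborel w" "\<And>z. \<beta> z = 0 \<Longrightarrow> w z = 0"
    "\<And>\<phi>. \<phi> \<in> test_functions \<Longrightarrow> has_bochner_integral lborel
       (\<lambda>z. laplacian \<phi> z * \<rho> z + (w z *\<^sub>R e1 + gradient \<beta> z) \<bullet> gradient \<phi> z) 0"
    "unbounded_variation \<rho>"
    "(\<forall>z. \<exists>U. open U \<and> z \<in> U \<and> finite {n. U \<inter> K n \<noteq> {}}) \<longrightarrow> C_infinity \<rho> \<and> C_infinity w"
proof -
  have "\<exists>\<delta>>0. \<forall>z\<in>K n. \<delta> \<le> \<beta> z" for n
  proof -
    have "K n \<noteq> {}" "compact (K n)" using r[of n] by (auto simp: K_def)
    then obtain x where "x \<in> K n" "\<forall>z\<in>K n. \<beta> x \<le> \<beta> z"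
      using continuous_attains_inf[of "K n" \<beta>] C_infinity_continuous[OF \<beta>(1)] by blast
    then show ?thesis using pos by blast
  qed
  then obtain \<delta> where \<delta>: "\<And>n. \<delta> n > 0" "\<And>n z. z \<in> K n \<Longrightarrow> \<delta> n \<le> \<beta> z" by metis
  \<comment> \<open>\<delta> n / 2 keeps the packet below half the background on its disc; (1/2)^n
    makes the series of suprema and of flux norms converge. The prescribed variation n is unaffected
    by either.\<close>
  define \<epsilon> where "\<epsilon> n = min (\<delta> n / 2) ((1/2) ^ n)" for n
  have "\<exists>f w \<phi> \<psi>. packet (K n) (\<epsilon> n) (\<epsilon> n) (real n) f w \<phi> \<psi>" for n
    unfolding K_def using r[of n] \<delta>(1)[of n] by (intro packet_exists) (auto simp: \<epsilon>_def)
  then obtain f w \<phi> \<psi> where p: "\<And>n. packet (K n) (\<epsilon> n) (\<epsilon> n) (real n) (f n) (w n) (\<phi> n) (\<psi> n)"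
    by metis
  have C: "C_infinity (f n)" "C_infinity (w n)" "C_infinity (\<phi> n)" "C_infinity (\<psi> n)" for n
    using p[of n] by (auto simp: packet_def)
  have zero: "f n z = 0" "w n z = 0" "\<phi> n z = 0" "\<psi> n z = 0" if "z \<notin> K n" for n z
    using p[of n] that by (auto simp: packet_def)
  have f_le: "\<bar>f n z\<bar> \<le> \<epsilon> n" and int_w: "(\<integral>z. \<bar>w n z\<bar> \<partial>lborel) \<le> \<epsilon> n" for n z
    using p[of n] by (auto simp: packet_def)
  have \<epsilon>: "\<epsilon> n \<le> (1/2) ^ n" "\<epsilon> n > 0" for n using \<delta>(1)[of n] by (auto simp: \<epsilon>_def)
  have sum_\<epsilon>: "summable (\<lambda>n. C * \<epsilon> n)" for C
    using \<epsilon> less_imp_le[OF \<epsilon>(2)]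
    by (intro summable_mult summable_comparison_test'[OF summable_geometric[of "1/2"], of 0 \<epsilon>]) auto
  have cs: "compactly_supported (w n)" "\<phi> n \<in> test_functions" "\<psi> n \<in> test_functions" for n
    using zero[of _ n] C[of n]
    by (auto simp: test_functions_def K_def intro!: compactly_supportedI[OF compact_cball[of "c n" "r n"]])
  define F where "F z = (\<Sum>n. f n z)" for z
  define V where "V z = (\<Sum>n. w n z)" for z
  have zero': "\<forall>n z. z \<notin> K n \<longrightarrow> f n z = 0" "\<forall>n z. z \<notin> K n \<longrightarrow> w n z = 0"
    using zero by blast+
  note sumF = suminf_disjoint[OF disj zero'(1), folded F_def]
  note sumV = suminf_disjoint[OF disj zero'(2), folded V_def]
  have [measurable]: "w n \<in> borel_measurable borel" "f n \<in> borel_measurable borel" for n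
    using C by (auto intro: borel_measurable_continuous C_infinity_continuous)
  have iw: "integrable lborel (w n)" for n
    using C cs by (intro integrable_compactly_supported C_infinity_continuous)
  have F_le: "\<bar>F z\<bar> \<le> \<beta> z / 2" for z
  proof (cases "\<exists>n. z \<in> K n")
    case True
    then obtain n where n: "z \<in> K n" by auto
    then have "\<bar>F z\<bar> \<le> \<delta> n / 2" using f_le[of n z] sumF(1)[OF n] by (simp add: \<epsilon>_def)
    then show ?thesis using \<delta>(2)[OF n] by simp
  next
    case False
    then show ?thesis using sumF(2) \<beta>(2) by simp
  qed
  \<comment> \<open>Convergence is uniform on the whole plane, so continuity holds even where the
    discs accumulate.\<close>
  have contF: "continuous_on UNIV F"
  proof -
    have "uniform_limit UNIV (\<lambda>n z. \<Sum>i<n. f i z) F sequentially"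
      unfolding F_def using f_le sum_\<epsilon>[of 1] by (intro Weierstrass_m_test) auto
    then show ?thesis
      by (rule uniform_limit_theorem[rotated])
         (auto intro!: always_eventually C_infinity_continuous C_infinity_sum C)
  qed
  have measV: "V \<in> borel_measurable borel"
    unfolding V_def by measurable
  have intV: "integrable lborel V"
    unfolding V_def
  proof (rule integrable_suminf[OF iw])
    show "AE z in lborel. summable (\<lambda>n. norm (w n z))" using sumV(3) by simp
    show "summable (\<lambda>n. \<integral>z. norm (w n z) \<partial>lborel)"
      using int_w by (intro summable_comparison_test'[OF sum_\<epsilon>[of 1], of 0]) (auto simp: integral_nonneg_AE)
  qed
  have V0: "V z = 0" if "\<beta> z = 0" for z
    using sumV(2) pos that by (metis less_irrefl)
  have weak: "has_bochner_integral lborel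
       (\<lambda>z. laplacian \<phi> z * (\<beta> z + F z) + (V z *\<^sub>R e1 + gradient \<beta> z) \<bullet> gradient \<phi> z) 0"
    if \<phi>: "\<phi> \<in> test_functions" for \<phi>
  proof -
    define G where "G n z = laplacian \<phi> z * f n z + w n z * directional_deriv e1 \<phi> z" for n z
    have lap_test: "laplacian \<phi> \<in> borel_measurable borel" "integrable lborel (laplacian \<phi>)"
    proof -
      have *: "continuous_on UNIV (directional_deriv v (directional_deriv v \<phi>))"
        "integrable lborel (directional_deriv v (directional_deriv v \<phi>))" for v
        using test_functions_directional[OF test_functions_directional[OF \<phi>], of v v]
        by (auto intro: integrable_compactly_supported C_infinity_continuous simp: test_functions_def)
      show "integrable lborel (laplacian \<phi>)"
        unfolding laplacian_2 [abs_def] by (intro Bochner_Integration.integrable_add *)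
      show "laplacian \<phi> \<in> borel_measurable borel"
        unfolding laplacian_2 [abs_def] by (intro borel_measurable_continuous continuous_on_add *)
    qed
    obtain B where B: "\<And>z. \<bar>directional_deriv e1 \<phi> z\<bar> \<le> B"
      using bounded_compactly_supported[of "directional_deriv e1 \<phi>"] test_functions_directional[OF \<phi>, of e1]
        test_functions_continuous by (metis (no_types, lifting) mem_Collect_eq real_norm_def test_functions_def)
    have Dm: "directional_deriv e1 \<phi> \<in> borel_measurable borel"
      using test_functions_directional[OF \<phi>] by (intro borel_measurable_continuous test_functions_continuous)
    have hG: "has_bochner_integral lborel (G n) 0" for n
      unfolding G_def [abs_def] by (rule packet_weak[OF p \<phi>])
    then have iG: "integrable lborel (G n)" and G0: "integral\<^sup>L lborel (G n) = 0" for n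
      by (auto simp: has_bochner_integral_iff)
    \<comment> \<open>Since \<epsilon> n bounds both the supremum of \<open>f n\<close> and the L^1
      norm of \<open>w n\<close>, a single summable series dominates both terms and the weak
      identities may be added up under the integral.\<close>
    have G_norm: "(\<integral>z. norm (G n z) \<partial>lborel) \<le> ((\<integral>z. \<bar>laplacian \<phi> z\<bar> \<partial>lborel) + B) * \<epsilon> n" for n
    proof -
      have "f n \<in> borel_measurable borel" by measurable
      note l = integrable_mult_bounded[OF lap_test(2) this f_le]
      note u = integrable_mult_bounded[OF iw[of n] Dm B]
      have "(\<integral>z. norm (G n z) \<partial>lborel) \<le> (\<integral>z. \<bar>laplacian \<phi> z * f n z\<bar> + \<bar>w n z * directional_deriv e1 \<phi> z\<bar> \<partial>lborel)"
        using l u iG by (intro integral_mono) (auto simp: G_def)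
      also have "\<dots> = (\<integral>z. \<bar>laplacian \<phi> z * f n z\<bar> \<partial>lborel) + (\<integral>z. \<bar>w n z * directional_deriv e1 \<phi> z\<bar> \<partial>lborel)"
        using l u by (intro Bochner_Integration.integral_add) auto
      also have "\<dots> \<le> \<epsilon> n * (\<integral>z. \<bar>laplacian \<phi> z\<bar> \<partial>lborel) + B * \<epsilon> n"
        using l(2) u(2) mult_left_mono[OF int_w[of n] order_trans[OF abs_ge_zero B]] by (intro add_mono) linarith+
      finally show ?thesis by (simp add: algebra_simps)
    qed
    have sG: "summable (\<lambda>n. norm (G n z))" "(\<Sum>n. G n z) = laplacian \<phi> z * F z + V z * directional_deriv e1 \<phi> z" for z
    proof -
      show "summable (\<lambda>n. norm (G n z))"
        by (rule suminf_disjoint(3)[OF disj]) (simp add: G_def zero)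
      show "(\<Sum>n. G n z) = laplacian \<phi> z * F z + V z * directional_deriv e1 \<phi> z"
        unfolding G_def F_def V_def using summable_norm_cancel[OF sumF(3)] summable_norm_cancel[OF sumV(3)]
        by (subst suminf_add[symmetric]) (auto simp: suminf_mult suminf_mult2 summable_mult summable_mult2)
    qed
    have sGn: "summable (\<lambda>n. \<integral>z. norm (G n z) \<partial>lborel)"
      using G_norm by (intro summable_comparison_test'[OF sum_\<epsilon>, of 0]) (auto simp: integral_nonneg_AE)
    have "has_bochner_integral lborel (\<lambda>z. \<Sum>n. G n z) 0"
      unfolding has_bochner_integral_iff
      using integrable_suminf[OF iG _ sGn] integral_suminf[OF iG _ sGn] sG(1) G0 by simp
    then have "has_bochner_integral lborel (\<lambda>z. laplacian \<phi> z * F z + V z * directional_deriv e1 \<phi> z) 0"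
      by (simp add: sG(2))
    from has_bochner_integral_add[OF gradient_weak[OF \<beta>(1) \<phi>] this]
    show ?thesis
      by (rule has_bochner_integral_cong[OF refl, THEN iffD1, rotated -1])
         (simp_all add: inner_add_left inner_gradient_2 algebra_simps, simp add: axis_def)
  qed
  have uv: "unbounded_variation (\<lambda>z. \<beta> z + F z)"
    unfolding unbounded_variation_def
  proof (intro allI)
    fix M
    define A where "A = (\<integral>z. norm (gradient \<beta> z) \<partial>lborel)"
    \<comment> \<open>The background costs at most A in each of the two components.\<close>
    obtain n :: nat where n: "real n \<ge> M + 2 * A" using real_arch_simple by blast
    define dv where "dv z = directional_deriv e1 (\<phi> n) z + directional_deriv e2 (\<psi> n) z" for z
    have b: "\<bar>\<phi> n z\<bar> \<le> 1" "\<bar>\<psi> n z\<bar> \<le> 1" for z using p[of n] by (auto simp: packet_def)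
    have eB: "e1 \<in> Basis" "e2 \<in> Basis" by (auto simp: Basis_vec_def)
    note part = integral_directional_test_le[OF \<beta>(1) integrable_norm[OF \<beta>(4)], folded A_def]
    note p1 = part[OF eB(1) cs(2)[of n] b(1)] and p2 = part[OF eB(2) cs(3)[of n] b(2)]
    have dv0: "dv z = 0" if "z \<notin> K n" for z
      using directional_deriv_zero_outside[of "K n" "\<phi> n" z] directional_deriv_zero_outside[of "K n" "\<psi> n" z]
        zero(3,4)[of _ n] that by (simp add: dv_def K_def)
    \<comment> \<open>The test field of packet n is supported in \<open>K n\<close>, where the whole
      series reduces to \<open>f n\<close>.\<close>
    have F_dv: "F z * dv z = f n z * dv z" for z
      using dv0 sumF(1) by (cases "z \<in> K n") auto
    have id: "integrable lborel (\<lambda>z. f n z * dv z)"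
      using C(1) cs by (auto simp: dv_def distrib_left intro!: Bochner_Integration.integrable_add
          integrable_mult_test test_functions_directional C_infinity_continuous)
    have "(\<integral>z. (\<beta> z + F z) * dv z \<partial>lborel) =
        (\<integral>z. \<beta> z * directional_deriv e1 (\<phi> n) z + \<beta> z * directional_deriv e2 (\<psi> n) z + f n z * dv z \<partial>lborel)"
      by (simp add: distrib_right F_dv) (simp add: dv_def distrib_left)
    also have "\<dots> = (\<integral>z. \<beta> z * directional_deriv e1 (\<phi> n) z \<partial>lborel) +
        (\<integral>z. \<beta> z * directional_deriv e2 (\<psi> n) z \<partial>lborel) + (\<integral>z. f n z * dv z \<partial>lborel)"
      using p1(1) p2(1) id by simp
    also have "\<dots> \<ge> real n - 2 * A"
    proof -
      have "real n \<le> (\<integral>z. f n z * dv z \<partial>lborel)" using p[of n] by (simp add: packet_def dv_def)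
      then show ?thesis using p1(2) p2(2) by linarith
    qed
    finally have "M \<le> (\<integral>z. (\<beta> z + F z) * dv z \<partial>lborel)" using n by linarith
    then show "\<exists>\<phi>\<in>test_functions. \<exists>\<psi>\<in>test_functions. (\<forall>z. \<bar>\<phi> z\<bar> \<le> 1 \<and> \<bar>\<psi> z\<bar> \<le> 1) \<and>
        M \<le> (\<integral>z. (\<beta> z + F z) * (directional_deriv e1 \<phi> z + directional_deriv e2 \<psi> z) \<partial>lborel)"
      using cs b unfolding dv_def by blast
  qed
  have smooth: "C_infinity (\<lambda>z. \<beta> z + F z) \<and> C_infinity V"
    if fin: "\<And>z. \<exists>U. open U \<and> z \<in> U \<and> finite {n. U \<inter> K n \<noteq> {}}"
  proof -
    have "C_infinity (\<lambda>z. \<Sum>n. h n z)"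
      if h: "\<And>n. C_infinity (h n)" "\<And>n z. z \<notin> K n \<Longrightarrow> h n z = 0" for h :: "nat \<Rightarrow> real^2 \<Rightarrow> real"
    proof (rule C_infinity_local)
      fix z
      obtain U where U: "open U" "z \<in> U" "finite {n. U \<inter> K n \<noteq> {}}" using fin by blast
      have "(\<Sum>n. h n y) = (\<Sum>n\<in>{n. U \<inter> K n \<noteq> {}}. h n y)" if "y \<in> U" for y
        using U(3) h(2) that by (intro suminf_finite) auto
      then show "\<exists>U g. open U \<and> z \<in> U \<and> C_infinity g \<and> (\<forall>y\<in>U. (\<Sum>n. h n y) = g y)"
        using U h(1) by (intro exI[of _ U] exI[of _ "\<lambda>y. \<Sum>n\<in>{n. U \<inter> K n \<noteq> {}}. h n y"]) (auto intro: C_infinity_sum)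
    qed
    then show ?thesis
      unfolding F_def [abs_def] V_def [abs_def] using C zero \<beta>(1) by (auto intro!: C_infinity_add)
  qed
  show ?thesis
  proof (rule that[of "\<lambda>z. \<beta> z + F z" V])
    show "continuous_on UNIV (\<lambda>z. \<beta> z + F z)"
      by (intro continuous_on_add contF C_infinity_continuous \<beta>)
    show "\<beta> z / 2 \<le> \<beta> z + F z" "\<beta> z + F z \<le> 2 * \<beta> z" for z
      using F_le[of z] \<beta>(2)[of z] by linarith+
  qed (use measV intV V0 weak uv smooth in auto)
qed

text \<open>Estimates are carried out over \<open>lborel\<close>, whereas the notions in the theorem
  use its completion; for Borel functions the integrals agree.\<close>

lemma has_bochner_integral_lebesgue:
  fixes f :: "'a::euclidean_space \<Rightarrow> 'b::{banach, second_countable_topology}"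
  assumes "f \<in> borel_measurable borel" "has_bochner_integral lborel f x"
  shows "has_bochner_integral lebesgue f x"
proof -
  have m: "f \<in> borel_measurable lborel" using assms(1) by simp
  show ?thesis
    using assms(2) unfolding has_bochner_integral_iff integrable_completion[OF m] integral_completion[OF m] .
qed

text \<open>The flux v is fixed first and b is defined as v / \<rho>. Then |b| \<rho> = |v| is
  integrable however large b becomes near zeros of \<rho>. Dividing \<rho> by its mass leaves b
  unchanged because the equation is linear in \<rho>.\<close>

lemma stationary_pair_exists:
  fixes \<beta> :: "real^2 \<Rightarrow> real" and c :: "nat \<Rightarrow> real^2" and r :: "nat \<Rightarrow> real"
  assumes \<beta>: "C_infinity \<beta>" "\<And>z. 0 \<le> \<beta> z" "integrable lborel \<beta>" "integrable lborel (gradient \<beta>)"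
    and K: "disjoint_family (\<lambda>n. cball (c n) (r n))" "\<And>n. r n > 0" "\<And>n z. z \<in> cball (c n) (r n) \<Longrightarrow> \<beta> z > 0"
  obtains \<rho> b where "probability_density \<rho>" "continuous_on UNIV \<rho>" "b \<in> borel_measurable borel"
    "weak_solution b \<rho>" "integrable lebesgue (\<lambda>z. norm (b z) * \<rho> z)" "unbounded_variation \<rho>"
    "\<And>z. \<beta> z = 0 \<Longrightarrow> \<rho> z = 0 \<and> b z = 0"
    "(\<forall>z. \<exists>U. open U \<and> z \<in> U \<and> finite {n. U \<inter> cball (c n) (r n) \<noteq> {}}) \<and> (\<forall>z. \<beta> z > 0) \<longrightarrow>
       C_infinity \<rho> \<and> C_infinity b"
proof -
  obtain \<rho> w where \<rho>: "continuous_on UNIV \<rho>" "\<And>z. \<beta> z / 2 \<le> \<rho> z" "\<And>z. \<rho> z \<le> 2 * \<beta> z"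
    and w: "w \<in> borel_measurable borel" "integrable lborel w" "\<And>z. \<beta> z = 0 \<Longrightarrow> w z = 0"
    and weak: "\<And>\<phi>. \<phi> \<in> test_functions \<Longrightarrow> has_bochner_integral lborel
       (\<lambda>z. laplacian \<phi> z * \<rho> z + (w z *\<^sub>R e1 + gradient \<beta> z) \<bullet> gradient \<phi> z) 0"
    and uv: "unbounded_variation \<rho>"
    and smooth: "(\<forall>z. \<exists>U. open U \<and> z \<in> U \<and> finite {n. U \<inter> cball (c n) (r n) \<noteq> {}}) \<longrightarrow> C_infinity \<rho> \<and> C_infinity w"
    by (rule packet_series[OF \<beta> K(1,2)], erule K(3), rule that)
  have [measurable]: "\<rho> \<in> borel_measurable borel" "w \<in> borel_measurable borel" "gradient \<beta> \<in> borel_measurable borel"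
    using \<rho>(1) w(1) \<beta>(1) by (auto intro: borel_measurable_continuous C_infinity_continuous C_infinity_gradient)
  have nonneg: "\<rho> z \<ge> 0" for z using \<rho>(2)[of z] \<beta>(2)[of z] by linarith
  have int\<rho>: "integrable lborel \<rho>"
    by (rule Bochner_Integration.integrable_bound[OF integrable_mult_right[OF \<beta>(3), of 2]])
       (use \<rho>(3) nonneg \<beta>(2) in auto)
  define Z where "Z = integral\<^sup>L lborel \<rho>"
  \<comment> \<open>Infinite variation also shows that the mass is positive: a density vanishing
    almost everywhere would have all pairings 0.\<close>
  have Z: "Z > 0"
  proof (rule ccontr)
    assume "\<not> Z > 0"
    then have "Z = 0" using nonneg by (simp add: Z_def not_less order_antisym)
    then have ae: "AE z in lborel. \<rho> z = 0"
      using integral_nonneg_eq_0_iff_AE[OF int\<rho>] nonneg by (simp add: Z_def)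
    obtain \<phi> \<psi> where "1 \<le> (\<integral>z. \<rho> z * (directional_deriv e1 \<phi> z + directional_deriv e2 \<psi> z) \<partial>lborel)"
      using uv unfolding unbounded_variation_def by blast
    moreover have "(\<integral>z. \<rho> z * (directional_deriv e1 \<phi> z + directional_deriv e2 \<psi> z) \<partial>lborel) = 0"
      using ae by (intro integral_eq_zero_AE) auto
    ultimately show False by simp
  qed
  define v where "v z = w z *\<^sub>R e1 + gradient \<beta> z" for z
  define b where "b z = inverse (\<rho> z) *\<^sub>R v z" for z
  \<comment> \<open>A zero of the nonnegative \<beta> is a minimum, hence a critical point.\<close>
  have grad0: "gradient \<beta> z = 0" if "\<beta> z = 0" for z
  proof -
    have "(\<lambda>u. directional_deriv u \<beta> z) = (\<lambda>u. 0)"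
      by (rule has_derivative_local_min[OF C_infinity_has_derivative[OF \<beta>(1)]])
         (use \<beta>(2) that in auto)
    then have "directional_deriv u \<beta> z = 0" for u by meson
    then show ?thesis by (simp add: gradient_2)
  qed
  \<comment> \<open>At zeros of \<rho> the convention \<open>inverse 0 = 0\<close> gives b = 0. This
    is consistent, because \<beta> vanishes there and with it both \<open>w\<close> and
    \<open>gradient \<beta>\<close>.\<close>
  have b\<rho>: "\<rho> z *\<^sub>R b z = v z" for z
  proof (cases "\<rho> z = 0")
    case True
    then have "\<beta> z = 0" using \<rho>(2)[of z] \<beta>(2)[of z] by simp
    then show ?thesis using True w(3) grad0 by (simp add: v_def)
  qed (simp add: b_def)
  have [measurable]: "v \<in> borel_measurable borel" unfolding v_def [abs_def] by measurable
  have bm [measurable]: "b \<in> borel_measurable borel" unfolding b_def [abs_def] by measurable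
  have intv: "integrable lborel v"
    unfolding v_def [abs_def] using w(2) \<beta>(4) by auto
  show ?thesis
  proof (rule that[of "\<lambda>z. \<rho> z / Z" b])
    have "has_bochner_integral lborel (\<lambda>z. \<rho> z / Z) 1"
      using int\<rho> Z by (simp add: has_bochner_integral_iff Z_def)
    then show "probability_density (\<lambda>z. \<rho> z / Z)"
      unfolding probability_density_def using nonneg Z by (auto intro!: has_bochner_integral_lebesgue)
    show "continuous_on UNIV (\<lambda>z. \<rho> z / Z)" using \<rho>(1) Z by (intro continuous_intros) auto
    show "b \<in> borel_measurable borel" by (rule bm)
    show "weak_solution b (\<lambda>z. \<rho> z / Z)"
      unfolding weak_solution_def
    proof
      fix \<phi> :: "real^2 \<Rightarrow> real" assume \<phi>: "\<phi> \<in> test_functions"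
      have eq: "(laplacian \<phi> z + b z \<bullet> gradient \<phi> z) * (\<rho> z / Z) =
          (laplacian \<phi> z * \<rho> z + (w z *\<^sub>R e1 + gradient \<beta> z) \<bullet> gradient \<phi> z) / Z" for z
        unfolding v_def[symmetric] b\<rho>[symmetric] by (simp add: algebra_simps add_divide_distrib)
      have [measurable]: "directional_deriv u (directional_deriv u \<phi>) \<in> borel_measurable borel"
        "gradient \<phi> \<in> borel_measurable borel" for u
        using \<phi> by (auto simp: test_functions_def intro!: borel_measurable_continuous C_infinity_continuous
            C_infinity_directional C_infinity_gradient)
      have m: "(\<lambda>z. (laplacian \<phi> z * \<rho> z + (w z *\<^sub>R e1 + gradient \<beta> z) \<bullet> gradient \<phi> z) / Z) \<in> borel_measurable borel"
        unfolding laplacian_2 by measurable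
      show "has_bochner_integral lebesgue (\<lambda>z. (laplacian \<phi> z + b z \<bullet> gradient \<phi> z) * (\<rho> z / Z)) 0"
        unfolding eq using has_bochner_integral_divide_zero[OF weak[OF \<phi>], of Z]
        by (intro has_bochner_integral_lebesgue m) simp
    qed
    have eq: "norm (b z) * (\<rho> z / Z) = norm (v z) / Z" for z
      using nonneg[of z] by (simp add: b\<rho>[symmetric] mult.commute)
    show "integrable lebesgue (\<lambda>z. norm (b z) * (\<rho> z / Z))"
      unfolding eq using intv by (subst integrable_completion) auto
    show "unbounded_variation (\<lambda>z. \<rho> z / Z)"
      unfolding unbounded_variation_def
    proof
      fix M
      obtain \<phi> \<psi> where "\<phi> \<in> test_functions" "\<psi> \<in> test_functions" "\<forall>z. \<bar>\<phi> z\<bar> \<le> 1 \<and> \<bar>\<psi> z\<bar> \<le> 1"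
        "M * Z \<le> (\<integral>z. \<rho> z * (directional_deriv e1 \<phi> z + directional_deriv e2 \<psi> z) \<partial>lborel)"
        using uv unfolding unbounded_variation_def by blast
      then show "\<exists>\<phi>\<in>test_functions. \<exists>\<psi>\<in>test_functions. (\<forall>z. \<bar>\<phi> z\<bar> \<le> 1 \<and> \<bar>\<psi> z\<bar> \<le> 1) \<and>
          M \<le> (\<integral>z. \<rho> z / Z * (directional_deriv e1 \<phi> z + directional_deriv e2 \<psi> z) \<partial>lborel)"
        using Z by (intro bexI[of _ \<phi>] bexI[of _ \<psi>]) (auto simp: field_simps)
    qed
    show "\<rho> z / Z = 0 \<and> b z = 0" if "\<beta> z = 0" for z
      using that \<rho>(2,3)[of z] by (simp add: b_def)
    show "(\<forall>z. \<exists>U. open U \<and> z \<in> U \<and> finite {n. U \<inter> cball (c n) (r n) \<noteq> {}}) \<and> (\<forall>z. \<beta> z > 0) \<longrightarrow>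
       C_infinity (\<lambda>z. \<rho> z / Z) \<and> C_infinity b"
    proof
      assume *: "(\<forall>z. \<exists>U. open U \<and> z \<in> U \<and> finite {n. U \<inter> cball (c n) (r n) \<noteq> {}}) \<and> (\<forall>z. \<beta> z > 0)"
      then have C: "C_infinity \<rho>" "C_infinity w" using smooth by auto
      have "\<rho> z \<noteq> 0" for z using \<rho>(2)[of z] * by (metis half_gt_zero less_le_trans less_irrefl)
      then show "C_infinity (\<lambda>z. \<rho> z / Z) \<and> C_infinity b"
        unfolding b_def [abs_def] v_def divide_inverse using C \<beta>(1)
        by (intro conjI C_infinity_mult C_infinity_scaleR C_infinity_inverse C_infinity_add C_infinity_gradient C_infinity_const)
    qed
  qed
qed

section \<open>Infinite variation against integrable derivatives\<close>

lemma unbounded_variation_imp_not_integrable_gradient: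
  assumes \<rho>: "C_infinity \<rho>" "unbounded_variation \<rho>"
  shows "\<not> integrable lebesgue (\<lambda>z. norm (gradient \<rho> z))"
proof
  assume "integrable lebesgue (\<lambda>z. norm (gradient \<rho> z))"
  moreover have m [measurable]: "gradient \<rho> \<in> borel_measurable borel" "directional_deriv v \<rho> \<in> borel_measurable borel" for v
    using \<rho>(1) by (auto intro!: borel_measurable_continuous C_infinity_continuous C_infinity_gradient C_infinity_directional)
  ultimately have i: "integrable lborel (\<lambda>z. norm (gradient \<rho> z))"
    by (simp add: integrable_completion)
  define A where "A = (\<integral>z. norm (gradient \<rho> z) \<partial>lborel)"
  note part = integral_directional_test_le[OF \<rho>(1) i, folded A_def]
  obtain \<phi> \<psi> where t: "\<phi> \<in> test_functions" "\<psi> \<in> test_functions" "\<And>z. \<bar>\<phi> z\<bar> \<le> 1" "\<And>z. \<bar>\<psi> z\<bar> \<le> 1"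
    "2 * A + 1 \<le> (\<integral>z. \<rho> z * (directional_deriv e1 \<phi> z + directional_deriv e2 \<psi> z) \<partial>lborel)"
    using \<rho>(2) unfolding unbounded_variation_def by blast
  have eB: "e1 \<in> Basis" "e2 \<in> Basis" by (auto simp: Basis_vec_def)
  note p = part[OF eB(1) t(1,3)] part[OF eB(2) t(2,4)]
  have "(\<integral>z. \<rho> z * (directional_deriv e1 \<phi> z + directional_deriv e2 \<psi> z) \<partial>lborel) =
      (\<integral>z. \<rho> z * directional_deriv e1 \<phi> z \<partial>lborel) + (\<integral>z. \<rho> z * directional_deriv e2 \<psi> z \<partial>lborel)"
    using p by (simp add: distrib_left)
  with t(5) p show False by linarith
qed

text \<open>An L^1 generalized derivative bounds every pairing in its direction by its norm, as
  integration by parts does in the smooth case. The two basis directions are estimated separately,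
  whence the threshold A1 + A2 + 1.\<close>

lemma unbounded_variation_imp_not_sobolev:
  assumes \<rho>: "continuous_on UNIV \<rho>" "unbounded_variation \<rho>"
  shows "\<rho> \<notin> sobolev 1 1"
proof
  assume S: "\<rho> \<in> sobolev 1 1"
  have bound: "\<exists>A. \<forall>\<eta>\<in>test_functions. (\<forall>z. \<bar>\<eta> z\<bar> \<le> 1) \<longrightarrow> \<bar>\<integral>z. \<rho> z * directional_deriv v \<eta> z \<partial>lborel\<bar> \<le> A"
    if v: "v \<in> Basis" for v
  proof -
    obtain g where g: "g \<in> Lp_space 1" "generalized_deriv [v] \<rho> g"
      using S v unfolding sobolev_def by (auto dest!: spec[of _ "[v]"])
    have ig: "integrable lebesgue g"
      using g(1) by (auto simp: Lp_space_def powr_one' intro: integrable_abs_cancel)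
    have "\<bar>\<integral>z. \<rho> z * directional_deriv v \<eta> z \<partial>lborel\<bar> \<le> (\<integral>z. \<bar>g z\<bar> \<partial>lebesgue)"
      if \<eta>: "\<eta> \<in> test_functions" "\<forall>z. \<bar>\<eta> z\<bar> \<le> 1" for \<eta>
    proof -
      have "(\<lambda>z. \<rho> z * directional_deriv v \<eta> z) \<in> borel_measurable borel"
        using \<rho>(1) test_functions_continuous[OF test_functions_directional[OF \<eta>(1)]]
        by (intro borel_measurable_continuous continuous_on_mult)
      then have "(\<integral>z. \<rho> z * directional_deriv v \<eta> z \<partial>lborel) = (\<integral>z. \<rho> z * directional_deriv v \<eta> z \<partial>lebesgue)"
        by (simp add: integral_completion)
      also have "\<dots> = - (\<integral>z. g z * \<eta> z \<partial>lebesgue)"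
        using g(2) \<eta>(1) by (simp add: generalized_deriv_def iterated_deriv_def)
      finally have "\<bar>\<integral>z. \<rho> z * directional_deriv v \<eta> z \<partial>lborel\<bar> \<le> (\<integral>z. \<bar>g z * \<eta> z\<bar> \<partial>lebesgue)"
        using integral_norm_bound[of lebesgue "\<lambda>z. g z * \<eta> z"] by simp
      also have "\<dots> \<le> (\<integral>z. \<bar>g z\<bar> \<partial>lebesgue)"
        using ig \<eta>(2) by (intro integral_mono') (auto simp: abs_mult mult_left_le)
      finally show ?thesis .
    qed
    then show ?thesis by blast
  qed
  have eB: "e1 \<in> Basis" "e2 \<in> Basis" by (auto simp: Basis_vec_def)
  obtain A1 where A1: "\<forall>\<eta>\<in>test_functions. (\<forall>z. \<bar>\<eta> z\<bar> \<le> 1) \<longrightarrow> \<bar>\<integral>z. \<rho> z * directional_deriv e1 \<eta> z \<partial>lborel\<bar> \<le> A1"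
    using bound[OF eB(1)] by blast
  obtain A2 where A2: "\<forall>\<eta>\<in>test_functions. (\<forall>z. \<bar>\<eta> z\<bar> \<le> 1) \<longrightarrow> \<bar>\<integral>z. \<rho> z * directional_deriv e2 \<eta> z \<partial>lborel\<bar> \<le> A2"
    using bound[OF eB(2)] by blast
  obtain \<phi> \<psi> where t: "\<phi> \<in> test_functions" "\<psi> \<in> test_functions" "\<forall>z. \<bar>\<phi> z\<bar> \<le> 1" "\<forall>z. \<bar>\<psi> z\<bar> \<le> 1"
    "A1 + A2 + 1 \<le> (\<integral>z. \<rho> z * (directional_deriv e1 \<phi> z + directional_deriv e2 \<psi> z) \<partial>lborel)"
    using \<rho>(2) unfolding unbounded_variation_def by blast
  have "integrable lborel (\<lambda>z. \<rho> z * directional_deriv v \<eta> z)" if "\<eta> \<in> test_functions" for v \<eta>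
    using \<rho>(1) that by (intro integrable_mult_test test_functions_directional)
  from Bochner_Integration.integral_add[OF this[OF t(1)] this[OF t(2)], of e1 e2]
  have "(\<integral>z. \<rho> z * (directional_deriv e1 \<phi> z + directional_deriv e2 \<psi> z) \<partial>lborel) =
      (\<integral>z. \<rho> z * directional_deriv e1 \<phi> z \<partial>lborel) + (\<integral>z. \<rho> z * directional_deriv e2 \<psi> z \<partial>lborel)"
    by (simp only: distrib_left)
  with t(5) A1[rule_format, OF t(1) t(3)[rule_format]] A2[rule_format, OF t(2) t(4)[rule_format]] show False by linarith
qed

section \<open>The two examples\<close>

abbreviation bracket_weight :: "real^2 \<Rightarrow> real" where
  "bracket_weight \<equiv> \<lambda>z. inverse ((1 + z \<bullet> z)\<^sup>2)"

lemma C_infinity_bracket_weight: "C_infinity bracket_weight"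
proof -
  have "C_infinity (\<lambda>z::real^2. (1 + z \<bullet> z) * (1 + z \<bullet> z))"
    by (intro C_infinity_mult C_infinity_add C_infinity_const C_infinity_inner C_infinity_ident)
  then show ?thesis
    unfolding power2_eq_square by (rule C_infinity_inverse) (smt (verit) inner_ge_zero mult_eq_0_iff)
qed

text \<open>Comparison with a series of disc indicators replaces polar coordinates: the weight 16 *
  16^-n on a disc of area pi 4^n has integral 16 pi 4^-n, a geometric series.\<close>

lemma integrable_bracket_weight: "integrable lborel bracket_weight"
proof -
  define h where "h n z = 16 * (1/16) ^ n * (indicator (cball 0 (2 ^ n)) z :: real)" for n and z :: "real^2"
  have h_nonneg: "0 \<le> h n z" for n z by (simp add: h_def)
  have ih: "integrable lborel (h n)" "integral\<^sup>L lborel (h n) = 16 * pi * (1/4) ^ n" for n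
  proof -
    have i: "integrable lborel (\<lambda>z. indicator (cball (0::real^2) (2 ^ n)) z :: real)"
      using emeasure_compact_finite[OF compact_cball[of "0::real^2" "2 ^ n"]] by (intro integrable_real_indicator) auto
    then show "integrable lborel (h n)" unfolding h_def by (intro integrable_mult_right)
    have "integral\<^sup>L lborel (h n) = 16 * (1/16) ^ n * (pi * (2 ^ n)\<^sup>2)"
      unfolding h_def using i by (simp add: measure_cball_2)
    also have "(2 ^ n)\<^sup>2 = (4::real) ^ n" by (simp add: power2_eq_square power_mult_distrib[symmetric])
    also have "16 * (1/16) ^ n * (pi * 4 ^ n) = 16 * pi * (((1/16) * 4) ^ n :: real)"
      by (simp only: power_mult_distrib mult_ac)
    finally show "integral\<^sup>L lborel (h n) = 16 * pi * (1/4) ^ n" by simp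
  qed
  have sh: "summable (\<lambda>n. h n z)" for z
    by (rule summable_comparison_test'[of "\<lambda>n. 16 * (1/16) ^ n" 0])
       (auto simp: h_def indicator_def intro!: summable_mult summable_geometric)
  have "integrable lborel (\<lambda>z. \<Sum>n. h n z)"
    by (rule integrable_suminf[OF ih(1)])
       (auto simp: h_nonneg sh ih(2) intro!: summable_mult summable_geometric)
  then show ?thesis
  proof (rule Bochner_Integration.integrable_bound)
    show "bracket_weight \<in> borel_measurable lborel"
      using borel_measurable_continuous[OF C_infinity_continuous[OF C_infinity_bracket_weight]] by simp
    have "bracket_weight z \<le> (\<Sum>n. h n z)" for z
    proof -
      obtain k where "norm z < 2 ^ k" using real_arch_pow[of 2 "norm z"] by auto
      then have ex: "\<exists>n. norm z \<le> 2 ^ n" using less_imp_le by blast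
      \<comment> \<open>Minimality of n gives |z| > 2^(n-1) for n > 0, hence the bound 16^-(n-1) =
        16 * 16^-n, the origin of the factor 16. For n = 0 the weight is at most 1.\<close>
      define n where "n = (LEAST n. norm z \<le> 2 ^ n)"
      have n: "norm z \<le> 2 ^ n" unfolding n_def using ex by (rule LeastI_ex)
      have "bracket_weight z \<le> 16 * (1/16) ^ n"
      proof (cases n)
        case 0
        have "1 \<le> (1 + z \<bullet> z)\<^sup>2" by (simp add: one_le_power)
        then show ?thesis using 0 by (simp add: inverse_le_1_iff order_trans[of _ 1])
      next
        case (Suc m)
        then have "\<not> norm z \<le> 2 ^ m" unfolding n_def using not_less_Least[of m "\<lambda>n. norm z \<le> 2 ^ n"] by auto
        then have "(2 ^ m)\<^sup>2 \<le> (norm z)\<^sup>2" by (intro power_mono) auto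
        then have "(2 ^ m)\<^sup>2 \<le> 1 + z \<bullet> z" unfolding dot_square_norm by linarith
        then have "((2 ^ m)\<^sup>2)\<^sup>2 \<le> (1 + z \<bullet> z)\<^sup>2" by (intro power_mono) auto
        moreover have "((2 ^ m)\<^sup>2)\<^sup>2 = (16::real) ^ m"
          by (simp add: power2_eq_square power_mult_distrib[symmetric])
        ultimately have "bracket_weight z \<le> inverse (16 ^ m)" by (intro le_imp_inverse_le) auto
        then show ?thesis using Suc by (simp add: power_one_over inverse_eq_divide)
      qed
      also have "\<dots> = (\<Sum>i\<in>{n}. h i z)" using n by (simp add: h_def)
      also have "\<dots> \<le> (\<Sum>n. h n z)" using sh h_nonneg by (intro sum_le_suminf) auto
      finally show ?thesis .
    qed
    then show "AE z in lborel. norm (bracket_weight z) \<le> norm (\<Sum>n. h n z)"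
      by (auto intro!: AE_I2 order_trans[OF _ abs_ge_self])
  qed
qed

text \<open>With q = 1 + |z|^2 a partial derivative has size 4 |z_i| q^-3, and |z_i| \<le> q turns
  this into 4 q^-2; the two components add up to 8.\<close>

lemma integrable_gradient_bracket_weight: "integrable lborel (gradient bracket_weight)"
proof (rule Bochner_Integration.integrable_bound[OF integrable_mult_right[OF integrable_bracket_weight, of 8]])
  show "gradient bracket_weight \<in> borel_measurable lborel"
    using borel_measurable_continuous[OF C_infinity_continuous[OF C_infinity_gradient[OF C_infinity_bracket_weight]]] by simp
  have D: "\<bar>directional_deriv (axis i 1) bracket_weight z\<bar> \<le> 4 * bracket_weight z" for i z
  proof -
    define q where "q = 1 + z \<bullet> z"
    have q: "q \<ge> 1" by (simp add: q_def)
    have "((\<lambda>t. inverse ((1 + t)\<^sup>2)) has_real_derivative - 2 * inverse (q ^ 3)) (at (z \<bullet> z))"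
    proof -
      have "((\<lambda>t. (1 + t)\<^sup>2) has_real_derivative 2 * q) (at (z \<bullet> z))"
        by (auto intro!: derivative_eq_intros simp: q_def)
      from DERIV_inverse'[OF this] show ?thesis
        using q by (auto elim!: DERIV_cong simp flip: q_def simp: power2_eq_square power3_eq_cube)
    qed
    from directional_deriv_radial_at[OF this]
    have "directional_deriv (axis i 1) bracket_weight z = 2 * (z $ i) * (- 2 * inverse (q ^ 3))"
      by (simp add: inner_axis)
    then have "\<bar>directional_deriv (axis i 1) bracket_weight z\<bar> = 4 * (\<bar>z $ i\<bar> * inverse (q ^ 3))"
      using q by (simp add: abs_mult)
    also have "\<bar>z $ i\<bar> \<le> q"
    proof -
      have "\<bar>z $ i\<bar> \<le> norm z" by (rule component_le_norm_cart)
      also have "\<dots> \<le> q"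
      proof -
        have "2 * norm z \<le> 1 + (norm z)\<^sup>2" using zero_le_power2[of "norm z - 1"] by (simp add: power2_diff)
        then show ?thesis unfolding q_def dot_square_norm using norm_ge_zero[of z] by linarith
      qed
      finally show ?thesis .
    qed
    then have "4 * (\<bar>z $ i\<bar> * inverse (q ^ 3)) \<le> 4 * (q * inverse (q ^ 3))"
      using q by (intro mult_left_mono mult_right_mono) auto
    also have "q * inverse (q ^ 3) = inverse (q\<^sup>2)"
      using q by (simp add: power2_eq_square power3_eq_cube field_simps)
    finally show ?thesis by (simp add: q_def)
  qed
  have "norm (gradient bracket_weight z) \<le> 8 * bracket_weight z" for z
    unfolding gradient_2 using D[of 1 z] D[of 2 z]
    by (intro order_trans[OF norm_triangle_ineq]) simp
  then show "AE z in lborel. norm (gradient bracket_weight z) \<le> norm (8 * bracket_weight z)"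
    by (auto intro!: AE_I2 order_trans[OF _ abs_ge_self])
qed

text \<open>For a = 1 this is the background of (a), zero exactly outside the open unit disc; for a
  = 1/4 it is a cutoff equal to 1 on the closed unit disc.\<close>

abbreviation bump :: "real \<Rightarrow> real^2 \<Rightarrow> real" where
  "bump a \<equiv> \<lambda>z. 1 - smooth_step (a * (z \<bullet> z))"

lemma C_infinity_bump: "C_infinity (bump a)"
  using C_infinity_diff[OF C_infinity_const C_infinity_smooth_step_cmult[of a], of 1]
  by (rule C_infinity_radial)

lemma compactly_supported_bump: "a > 0 \<Longrightarrow> compactly_supported (bump a)"
proof (rule compactly_supportedI[OF compact_cball])
  fix z :: "real^2"
  assume a: "a > 0" and "z \<notin> cball 0 (1 / sqrt a)"
  then have "(1 / sqrt a)\<^sup>2 \<le> (norm z)\<^sup>2" by (intro power_mono) auto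
  then have "1 \<le> a * (z \<bullet> z)" using a by (simp add: power_divide dot_square_norm field_simps)
  then show "bump a z = 0" by (simp add: smooth_step_eq_1)
qed

lemma bump_test_function: "a > 0 \<Longrightarrow> bump a \<in> test_functions"
  unfolding test_functions_def using C_infinity_bump compactly_supported_bump by blast

lemma disjoint_family_nat_cball:
  fixes c :: "nat \<Rightarrow> 'a::metric_space"
  assumes "\<And>m n. m < n \<Longrightarrow> dist (c m) (c n) > r m + r n"
  shows "disjoint_family (\<lambda>n. cball (c n) (r n))"
  unfolding disjoint_family_on_def
proof (intro ballI impI)
  fix m n :: nat assume "m \<noteq> n"
  then show "cball (c m) (r m) \<inter> cball (c n) (r n) = {}"
    using assms[of m n] assms[of n m] disjoint_cballI[of "r m" "r n" "c m" "c n"] disjoint_cballI[of "r n" "r m" "c n" "c m"]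
    by (metis Int_commute linorder_neqE_nat)
qed

lemma singular_compactly_supported_density:
  "\<exists>(\<rho> :: real^2 \<Rightarrow> real) (b :: real^2 \<Rightarrow> real^2).
      probability_density \<rho> \<and> continuous_on UNIV \<rho> \<and> compactly_supported \<rho> \<and>
      b \<in> borel_measurable borel \<and> compactly_supported b \<and>
      integrable lebesgue (\<lambda>x. norm (b x) * \<rho> x) \<and>
      weak_solution b \<rho> \<and> \<rho> \<notin> sobolev_loc 1 1"
proof -
  \<comment> \<open>For m < n the centres are at least 2^-m / 4 apart while the radii add up to at
    most (3/16) 2^-m. All discs stay within |z| \<le> 5/8 and shrink to the origin, where the
    background is still positive.\<close>
  define c :: "nat \<Rightarrow> real^2" where "c n = ((1/2) ^ n / 2) *\<^sub>R e1" for n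
  define r :: "nat \<Rightarrow> real" where "r n = (1/2) ^ n / 8" for n
  have pos: "r n > 0" for n by (simp add: r_def)
  have disj: "disjoint_family (\<lambda>n. cball (c n) (r n))"
  proof (rule disjoint_family_nat_cball)
    fix m n :: nat assume "m < n"
    then have "(1/2) ^ n \<le> (1/2 :: real) ^ Suc m" by (intro power_decreasing) auto
    then have le: "(1/2) ^ n \<le> (1/2) * (1/2 :: real) ^ m" by simp
    have "dist (c m) (c n) = \<bar>(1/2) ^ m / 2 - (1/2) ^ n / 2\<bar>"
      by (simp add: c_def dist_norm scaleR_left_diff_distrib[symmetric] del: power_one_over)
    moreover have "(1/2 :: real) ^ m > 0" by simp
    ultimately show "dist (c m) (c n) > r m + r n"
      using le unfolding r_def by linarith
  qed
  have small: "z \<bullet> z < 1" if "z \<in> cball (c n) (r n)" for z n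
  proof -
    have "norm z \<le> norm (c n) + dist (c n) z"
      using norm_triangle_ineq2[of z "c n"] by (simp add: dist_norm norm_minus_commute)
    also have "\<dots> \<le> (1/2) ^ n / 2 + (1/2) ^ n / 8" using that by (simp add: c_def r_def)
    finally have "norm z < 1" using power_le_one[of "1/2::real" n] by linarith
    then show ?thesis by (simp add: dot_square_norm power_less_one_iff abs_square_less_1)
  qed
  have cg: "compactly_supported (gradient (bump 1))"
  proof -
    obtain R where R: "R > 0" "\<And>z. z \<notin> cball 0 R \<Longrightarrow> bump 1 z = 0"
      using compactly_supportedE[OF compactly_supported_bump[of 1]] by (metis zero_less_one)
    have "gradient (bump 1) z = 0" if "z \<notin> cball 0 R" for z
      using directional_deriv_zero_outside[OF closed_cball R(2) that] by (simp add: gradient_2)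
    then show ?thesis by (intro compactly_supportedI[OF compact_cball[of 0 R]])
  qed
  obtain \<rho> b where \<rho>: "probability_density \<rho>" "continuous_on UNIV \<rho>" "b \<in> borel_measurable borel"
    "weak_solution b \<rho>" "integrable lebesgue (\<lambda>z. norm (b z) * \<rho> z)" "unbounded_variation \<rho>"
    "\<And>z. bump 1 z = 0 \<Longrightarrow> \<rho> z = 0 \<and> b z = 0"
  proof (rule stationary_pair_exists[of "bump 1" c r])
    show "C_infinity (bump 1)" by (rule C_infinity_bump)
    show "0 \<le> bump 1 z" for z using smooth_step_le_1[of "1 * (z \<bullet> z)"] by linarith
    show "integrable lborel (bump 1)"
      by (intro integrable_compactly_supported C_infinity_continuous C_infinity_bump compactly_supported_bump zero_less_one)
    show "integrable lborel (gradient (bump 1))"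
      by (intro integrable_compactly_supported C_infinity_continuous C_infinity_gradient C_infinity_bump cg)
    show "bump 1 z > 0" if "z \<in> cball (c n) (r n)" for n z
      using smooth_step_less_1[OF small[OF that]] by simp
  qed (use disj pos in auto)
  have zero: "\<rho> z = 0" "b z = 0" if "z \<notin> cball 0 1" for z
  proof -
    have "1\<^sup>2 \<le> (norm z)\<^sup>2" using that by (intro power_mono) auto
    then have "bump 1 z = 0" by (simp add: smooth_step_eq_1 dot_square_norm)
    then show "\<rho> z = 0" "b z = 0" using \<rho>(7) by auto
  qed
  have "\<rho> \<notin> sobolev_loc 1 1"
  proof
    assume "\<rho> \<in> sobolev_loc 1 1"
    then have "(\<lambda>z. bump (1/4) z * \<rho> z) \<in> sobolev 1 1"
      using bump_test_function[of "1/4"] unfolding sobolev_loc_def by simp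
    \<comment> \<open>The cutoff is 1 on the support of \<rho>, which reduces the local Sobolev
      class to the global one.\<close>
    moreover have "(\<lambda>z. bump (1/4) z * \<rho> z) = \<rho>"
    proof (rule ext)
      fix z
      show "bump (1/4) z * \<rho> z = \<rho> z"
      proof (cases "z \<in> cball 0 1")
      case True
      then have "z \<bullet> z \<le> 1" by (simp add: dot_square_norm power_le_one)
      then show ?thesis by (simp add: smooth_step_eq_0)
      qed (simp add: zero)
    qed
    ultimately have "\<rho> \<in> sobolev 1 1" by (simp only:)
    then show False using unbounded_variation_imp_not_sobolev[OF \<rho>(2,6)] by simp
  qed
  moreover have "compactly_supported \<rho>" "compactly_supported b"
    using zero by (auto intro!: compactly_supportedI[OF compact_cball[of 0 1]])
  ultimately show ?thesis using \<rho> by blast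
qed

lemma smooth_density_gradient_not_integrable:
  "\<exists>(\<rho> :: real^2 \<Rightarrow> real) (b :: real^2 \<Rightarrow> real^2).
      probability_density \<rho> \<and> C_infinity \<rho> \<and> C_infinity b \<and> weak_solution b \<rho> \<and>
      integrable lebesgue (\<lambda>x. norm (b x) * \<rho> x) \<and>
      \<not> integrable lebesgue (\<lambda>x. norm (gradient \<rho> x))"
proof -
  \<comment> \<open>Unit discs with centres 3 apart are disjoint, and a ball of radius 1 meets only
    finitely many of them, so the series is smooth.\<close>
  define c :: "nat \<Rightarrow> real^2" where "c n = (3 * real n) *\<^sub>R e1" for n
  have disj: "disjoint_family (\<lambda>n. cball (c n) 1)"
    by (rule disjoint_family_nat_cball)
       (simp add: c_def dist_norm scaleR_left_diff_distrib[symmetric])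
  have fin: "\<exists>U. open U \<and> z \<in> U \<and> finite {n. U \<inter> cball (c n) 1 \<noteq> {}}" for z
  proof (intro exI conjI)
    have le: "real n \<le> norm z + 2" if "ball z 1 \<inter> cball (c n) 1 \<noteq> {}" for n
    proof -
      obtain y where "dist z y < 1" "dist (c n) y \<le> 1" using \<open>ball z 1 \<inter> cball (c n) 1 \<noteq> {}\<close> by auto
      then have "dist (c n) z \<le> 2" using dist_triangle2[of "c n" z y] by linarith
      then have "norm (c n) \<le> norm z + 2" using norm_triangle_ineq2[of "c n" z] by (simp add: dist_norm)
      then show ?thesis by (simp add: c_def)
    qed
    obtain N :: nat where N: "norm z + 2 \<le> real N" using real_arch_simple by blast
    have "{n. ball z 1 \<inter> cball (c n) 1 \<noteq> {}} \<subseteq> {..N}"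
    proof
      fix n assume "n \<in> {n. ball z 1 \<inter> cball (c n) 1 \<noteq> {}}"
      then have "real n \<le> real N" using order_trans[OF le N] by (simp only: mem_Collect_eq)
      then show "n \<in> {..N}" by simp
    qed
    then show "finite {n. ball z 1 \<inter> cball (c n) 1 \<noteq> {}}" using finite_subset by blast
  qed auto
  have pos: "bracket_weight z > 0" for z
    using inner_ge_zero[of z] by (intro positive_imp_inverse_positive zero_less_power) linarith
  obtain \<rho> b where \<rho>: "probability_density \<rho>" "weak_solution b \<rho>"
    "integrable lebesgue (\<lambda>z. norm (b z) * \<rho> z)" "unbounded_variation \<rho>"
    "(\<forall>z. \<exists>U. open U \<and> z \<in> U \<and> finite {n. U \<inter> cball (c n) 1 \<noteq> {}}) \<and> (\<forall>z. bracket_weight z > 0) \<longrightarrow>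
       C_infinity \<rho> \<and> C_infinity b"
    by (rule stationary_pair_exists[of bracket_weight c "\<lambda>_. 1", OF C_infinity_bracket_weight less_imp_le[OF pos]
        integrable_bracket_weight integrable_gradient_bracket_weight disj zero_less_one pos], rule that)
  have C: "C_infinity \<rho> \<and> C_infinity b"
    using fin pos by (intro \<rho>(5)[THEN mp] conjI allI)
  then show ?thesis
    using \<rho>(1-4) unbounded_variation_imp_not_integrable_gradient[of \<rho>] by blast
qed

theorem theorem3p1:
  shows "(\<exists>(\<rho> :: real^2 \<Rightarrow> real) (b :: real^2 \<Rightarrow> real^2).
            probability_density \<rho> \<and> continuous_on UNIV \<rho> \<and> compactly_supported \<rho> \<and>
            b \<in> borel_measurable borel \<and> compactly_supported b \<and>
            integrable lebesgue (\<lambda>x. norm (b x) * \<rho> x) \<and>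
            weak_solution b \<rho> \<and>
            \<rho> \<notin> sobolev_loc 1 1)
       \<and> (\<exists>(\<rho> :: real^2 \<Rightarrow> real) (b :: real^2 \<Rightarrow> real^2).
            probability_density \<rho> \<and> C_infinity \<rho> \<and> C_infinity b \<and>
            weak_solution b \<rho> \<and>
            integrable lebesgue (\<lambda>x. norm (b x) * \<rho> x) \<and>
            \<not> integrable lebesgue (\<lambda>x. norm (gradient \<rho> x)))"
  using singular_compactly_supported_density smooth_density_gradient_not_integrable by (rule conjI)

end
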